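(* Let $1\le p<\infty$ and let $\alpha,\beta\in\mathbb{C}$ satisfy $|\alpha|^2+|\beta|^2=1$ and $\alpha\neq 0$. Let $\Lambda:H^p_{\alpha,\beta}\to\mathbb{C}$ be a continuous linear functional such that $\Lambda(f)\neq 0$ for every cyclic function $f\in H^p_{\alpha,\beta}$. Then there exist a non-zero scalar $c\in\mathbb{C}$ and a point $w\in\mathbb{D}$ such that $\Lambda(f)=c\,f(w)$ for all $f\in H^p_{\alpha,\beta}$.
   Context: $\mathbb{D}$ is the open unit disc in $\mathbb{C}$. For $1\le p<\infty$, $H^p$ is the Hardy space of analytic functions on $\mathbb{D}$ with its usual norm, and $H^\infty$ is the algebra of bounded analytic functions on $\mathbb{D}$. For $\alpha,\beta\in\mathbb{C}$ with $|\alpha|^2+|\beta|^2=1$, $H^p_{\alpha,\beta}=\mathrm{span}\{\alpha+\beta z,\ z^2H^p\}$, i.e. the set of functions $c(\alpha+\beta z)+z^2g$ with $c\in\mathbb{C}$, $g\in H^p$; it is a closed subspace of $H^p$ and carries the $H^p$ norm. Put $H^\infty_1=\{f\in H^\infty: f'(0)=0\}$. A function $f\in H^p_{\alpha,\beta}$ is called cyclic if $\overline{fH^\infty_1}=H^p_{\alpha,\beta}$, where $fH^\infty_1=\{fh:h\in H^\infty_1\}$ and the closure is taken in the $H^p$ norm. *)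

theory Defs
  imports "HOL-Complex_Analysis.Complex_Analysis"
begin

text \<open>
  Functions on the unit disc are represented by total functions on \<^typ>\<open>complex\<close> whose values
  outside the disc are irrelevant: the function spaces below are closed under changing such values.
  So, for \<open>p \<ge> 1\<close>, \<open>hardy_norm p\<close> is a seminorm on \<open>hardy p\<close> that identifies exactly the functions
  agreeing on the disc, and a linear functional that is continuous for it depends only on the
  values on the disc.
\<close>

abbreviation unit_disc :: "complex set" where
  "unit_disc \<equiv> ball 0 1"

definition circle_mean :: "real \<Rightarrow> (complex \<Rightarrow> complex) \<Rightarrow> real \<Rightarrow> real" where
  "circle_mean p f r =
     integral {0..2 * pi} (\<lambda>t. norm (f (of_real r * cis t)) powr p) / (2 * pi)"

definition hardy :: "real \<Rightarrow> (complex \<Rightarrow> complex) set" where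
  "hardy p = {f. f holomorphic_on unit_disc \<and> bdd_above (circle_mean p f ` {0..<1})}"

definition hardy_norm :: "real \<Rightarrow> (complex \<Rightarrow> complex) \<Rightarrow> real" where
  "hardy_norm p f = (SUP r\<in>{0..<1}. circle_mean p f r) powr (1 / p)"

definition hardy_inf :: "(complex \<Rightarrow> complex) set" where
  "hardy_inf = {f. f holomorphic_on unit_disc \<and> bounded (f ` unit_disc)}"

definition hardy_inf1 :: "(complex \<Rightarrow> complex) set" where
  "hardy_inf1 = {f \<in> hardy_inf. deriv f 0 = 0}"

definition hardy_ab :: "real \<Rightarrow> complex \<Rightarrow> complex \<Rightarrow> (complex \<Rightarrow> complex) set" where
  "hardy_ab p \<alpha> \<beta> =
     {f. \<exists>c. \<exists>g\<in>hardy p. \<forall>z\<in>unit_disc. f z = c * (\<alpha> + \<beta> * z) + z\<^sup>2 * g z}"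

definition hardy_closure :: "real \<Rightarrow> (complex \<Rightarrow> complex) set \<Rightarrow> (complex \<Rightarrow> complex) set" where
  "hardy_closure p S =
     {g \<in> hardy p. \<forall>\<epsilon>>0. \<exists>s\<in>S. hardy_norm p (\<lambda>z. g z - s z) < \<epsilon>}"

definition cyclic :: "real \<Rightarrow> complex \<Rightarrow> complex \<Rightarrow> (complex \<Rightarrow> complex) \<Rightarrow> bool" where
  "cyclic p \<alpha> \<beta> f \<longleftrightarrow> f \<in> hardy_ab p \<alpha> \<beta> \<and>
     hardy_closure p {(\<lambda>z. f z * h z) | h. h \<in> hardy_inf1} = hardy_ab p \<alpha> \<beta>"

definition linear_functional_on ::
    "(complex \<Rightarrow> complex) set \<Rightarrow> ((complex \<Rightarrow> complex) \<Rightarrow> complex) \<Rightarrow> bool" where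
  "linear_functional_on X \<Lambda> \<longleftrightarrow>
     (\<forall>f\<in>X. \<forall>g\<in>X. \<Lambda> (\<lambda>z. f z + g z) = \<Lambda> f + \<Lambda> g) \<and>
     (\<forall>a. \<forall>f\<in>X. \<Lambda> (\<lambda>z. a * f z) = a * \<Lambda> f)"

definition hardy_continuous_on ::
    "real \<Rightarrow> (complex \<Rightarrow> complex) set \<Rightarrow> ((complex \<Rightarrow> complex) \<Rightarrow> complex) \<Rightarrow> bool" where
  "hardy_continuous_on p X \<Lambda> \<longleftrightarrow>
     (\<forall>f\<in>X. \<forall>\<epsilon>>0. \<exists>\<delta>>0. \<forall>g\<in>X.
        hardy_norm p (\<lambda>z. g z - f z) < \<delta> \<longrightarrow> norm (\<Lambda> g - \<Lambda> f) < \<epsilon>)"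

end

theory Submission
  imports Defs
begin

text \<open>
  Put \<open>E(z) = exp(\<beta>z/\<alpha>)\<close>. If \<open>u\<close> is bounded with \<open>u'(0) = 0\<close>, then \<open>E exp(u)\<close> is bounded above and
  below, so it is cyclic as soon as dilations converge in \<open>H\<^sup>p\<close>. Hence \<open>L(h) = \<Lambda>(E h)\<close> does not vanish
  on exponentials, and as in the Gleason-Kahane-Zelazko theorem the entire function
  \<open>t \<mapsto> L(exp(t a))\<close> is zero-free of exponential type, hence an exponential; comparing coefficients
  shows that \<open>L / L(1)\<close> is multiplicative. So there is \<open>w\<close> with \<open>L(z\<^sup>n) = L(1) w\<^sup>n\<close> for \<open>n \<noteq> 1\<close>, and
  continuity of \<open>\<Lambda>\<close> forces \<open>|w| < 1\<close> and extends this to evaluation at \<open>w\<close>.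

  The convergence of dilations, including \<open>p = 1\<close>, is obtained without boundary values from the
  monotonicity in the radius of the means of \<open>|F|\<^sup>q\<close> for all \<open>q > 0\<close>.
\<close>

section \<open>Monotonicity of circle means\<close>

text \<open>The factor \<open>E\<close> is tied to the relation \<alpha> f'(0) = \<beta> f(0) that
  describes the space: \<open>E\<close> satisfies it and has a bounded inverse, so multiplication by
  \<open>E\<close> carries the H^p functions with vanishing derivative at 0 onto the space. The
  obvious candidate \<alpha> + \<beta>z has a zero in the disc when |\<alpha>| < |\<beta>|. The
  multiplier algebra does not contain the function z, so \<open>w\<close> cannot be read off from
  it; it is recovered from z^2 and z^3, which lie on the cusp x^3 = y^2. Boundedness of
  \<open>L\<close> in the supremum norm would still allow |w| = 1. This is excluded by continuity in
  the H^p norm, which makes L(h) the limit of the values of \<open>L\<close> on the dilations of h.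
  Convergence of dilations is a stability statement: on suitable circles the means of f, of its
  dilation, of their product (exponent p/2) and of their midpoint (exponent p) almost agree, and
  this forces the two functions to be close. The exponent p/2 is below 1 when p < 2, which is why
  monotonicity of means is proved for every q > 0.\<close>

text \<open>Where \<open>F k\<close> does not vanish, a suitably rotated local branch of its \<open>q\<close>-th power is holomorphic
  and positive at \<open>a\<close>; the maximum modulus principle applies to the sum of these branches.\<close>

lemma sum_powr_local_max:
  fixes F :: "'i \<Rightarrow> complex \<Rightarrow> complex"
  assumes fin: "finite K" and hol: "\<And>k. k \<in> K \<Longrightarrow> F k holomorphic_on ball a e" and e: "0 < e" and q: "0 < q"
    and mx: "\<And>z. z \<in> ball a e \<Longrightarrow>
      (\<Sum>k\<in>K. norm (F k z) powr q) \<le> (\<Sum>k\<in>K. norm (F k a) powr q)"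
  shows "\<exists>d>0. d \<le> e \<and> (\<forall>z\<in>ball a d. (\<Sum>k\<in>K. norm (F k z) powr q) = (\<Sum>k\<in>K. norm (F k a) powr q))"
proof -
  \<comment> \<open>Terms vanishing at \<open>a\<close> contribute nothing there and can only
    increase the sum elsewhere. So |G(z)| \<le> full sum at z \<le> full sum at \<open>a\<close> =
    |G(a)| on the ball, and constancy of \<open>G\<close> pins the full sum.\<close>
  define K' where "K' = {k \<in> K. F k a \<noteq> 0}"
  have fin': "finite K'" using fin by (simp add: K'_def)
  have "\<exists>d>0. d \<le> e \<and> (\<forall>k\<in>K'. \<forall>z\<in>ball a d. F k z \<noteq> 0)"
  proof -
    have "\<forall>k\<in>K'. eventually (\<lambda>z. F k z \<noteq> 0) (nhds a)"
    proof
      fix k assume "k \<in> K'"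
      then have "isCont (F k) a" "F k a \<noteq> 0"
        using hol[of k] e by (auto simp: K'_def intro!: continuous_on_interior[OF holomorphic_on_imp_continuous_on])
      then show "eventually (\<lambda>z. F k z \<noteq> 0) (nhds a)"
        by (metis isCont_def t1_space_nhds tendsto_imp_eventually_ne eventually_nhds_conv_at)
    qed
    then have "eventually (\<lambda>z. \<forall>k\<in>K'. F k z \<noteq> 0) (nhds a)"
      using fin' by (simp add: eventually_ball_finite)
    then obtain d where "d > 0" "\<And>z. dist z a < d \<Longrightarrow> \<forall>k\<in>K'. F k z \<noteq> 0"
      by (auto simp: eventually_nhds_metric)
    then show ?thesis using e
      by (intro exI[of _ "min d e"]) (auto simp: dist_commute)
  qed
  then obtain d where d: "d > 0" "d \<le> e" "\<And>k z. k \<in> K' \<Longrightarrow> z \<in> ball a d \<Longrightarrow> F k z \<noteq> 0" by blast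
  have "\<forall>k\<in>K'. \<exists>L. L holomorphic_on ball a d \<and> (\<forall>z\<in>ball a d. F k z = exp (L z))"
  proof
    fix k assume k: "k \<in> K'"
    have "F k holomorphic_on ball a d"
      using hol[of k] k d(2) by (auto simp: K'_def elim!: holomorphic_on_subset)
    from contractible_imp_holomorphic_log[OF this convex_imp_contractible[OF convex_ball]] d(3)[OF k]
    show "\<exists>L. L holomorphic_on ball a d \<and> (\<forall>z\<in>ball a d. F k z = exp (L z))" by metis
  qed
  then obtain L where L: "\<And>k. k \<in> K' \<Longrightarrow> L k holomorphic_on ball a d"
    "\<And>k z. k \<in> K' \<Longrightarrow> z \<in> ball a d \<Longrightarrow> F k z = exp (L k z)" by metis
  define E where "E k z = exp (of_real q * (L k z - \<i> * of_real (Im (L k a))))" for k z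
  define G where "G z = (\<Sum>k\<in>K'. E k z)" for z
  have nE: "norm (E k z) = norm (F k z) powr q" if "k \<in> K'" "z \<in> ball a d" for k z
    using L(2)[OF that] by (simp add: E_def powr_def)
  have Ea: "E k a = of_real (norm (F k a) powr q)" if "k \<in> K'" for k
  proof -
    have "L k a - \<i> * of_real (Im (L k a)) = of_real (Re (L k a))"
      by (simp add: complex_eq_iff)
    then have "E k a = of_real (exp (q * Re (L k a)))"
      by (simp add: E_def exp_of_real flip: of_real_mult)
    then show ?thesis using L(2)[OF that, of a] d(1) by (simp add: powr_def)
  qed
  have sumK: "(\<Sum>k\<in>K. norm (F k a) powr q) = (\<Sum>k\<in>K'. norm (F k a) powr q)"
    unfolding K'_def by (rule sum.mono_neutral_right) (use fin q in auto)
  have Ga: "G a = of_real (\<Sum>k\<in>K. norm (F k a) powr q)"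
    unfolding G_def sumK by (simp add: Ea)
  have Gz: "norm (G z) \<le> (\<Sum>k\<in>K. norm (F k z) powr q)" if z: "z \<in> ball a d" for z
  proof -
    have "norm (G z) \<le> (\<Sum>k\<in>K'. norm (F k z) powr q)"
      unfolding G_def by (rule sum_norm_le) (simp add: nE[OF _ z])
    also have "\<dots> \<le> (\<Sum>k\<in>K. norm (F k z) powr q)"
      by (rule sum_mono2) (use fin in \<open>auto simp: K'_def\<close>)
    finally show ?thesis .
  qed
  have nGa: "norm (G a) = (\<Sum>k\<in>K. norm (F k a) powr q)"
    unfolding Ga norm_of_real by (simp add: sum_nonneg)
  have "G holomorphic_on ball a d"
    unfolding G_def E_def by (intro holomorphic_intros L)
  then have "G constant_on ball a d"
  proof (rule maximum_modulus_principle[of _ _ "ball a d" a])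
    fix z assume z: "z \<in> ball a d"
    then show "norm (G z) \<le> norm (G a)"
      using Gz[OF z] mx[of z] d(2) nGa by auto
  qed (use d in auto)
  then have "norm (G z) = norm (G a)" if "z \<in> ball a d" for z
    using that d(1) unfolding constant_on_def by (metis centre_in_ball)
  then have "(\<Sum>k\<in>K. norm (F k z) powr q) = (\<Sum>k\<in>K. norm (F k a) powr q)" if "z \<in> ball a d" for z
    using that Gz[OF that] mx[of z] d(2) nGa by fastforce
  then show ?thesis using d by blast
qed

text \<open>The set \<open>M\<close> of maximum points is compact. By local constancy, a point of
  \<open>M\<close> farthest from 0 that lay inside the disc could be moved slightly outwards without
  leaving \<open>M\<close>.\<close>

lemma sum_powr_max_principle:
  fixes F :: "'i \<Rightarrow> complex \<Rightarrow> complex"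
  assumes fin: "finite K" and hol: "\<And>k. k \<in> K \<Longrightarrow> F k holomorphic_on S"
    and S: "open S" "cball 0 r \<subseteq> S" and r: "0 < r" and q: "0 < q" and z: "norm z \<le> r"
  shows "\<exists>\<zeta>. norm \<zeta> = r \<and> (\<Sum>k\<in>K. norm (F k z) powr q) \<le> (\<Sum>k\<in>K. norm (F k \<zeta>) powr q)"
proof -
  define u where "u z = (\<Sum>k\<in>K. norm (F k z) powr q)" for z
  have cont: "continuous_on (cball 0 r) u"
    unfolding u_def
    by (intro continuous_intros continuous_on_powr' continuous_on_subset[OF holomorphic_on_imp_continuous_on[OF hol] S(2)])
       (use q in auto)
  obtain z0 where z0: "z0 \<in> cball 0 r" "\<And>y. y \<in> cball 0 r \<Longrightarrow> u y \<le> u z0"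
    using continuous_attains_sup[OF _ _ cont] r by auto
  define M where "M = {y \<in> cball 0 r. u y = u z0}"
  have "closed M" unfolding M_def
    using continuous_closed_preimage_constant[OF cont, of "u z0"] by simp
  moreover have "M \<subseteq> cball 0 r" by (auto simp: M_def)
  ultimately have "compact M"
    by (metis bounded_cball bounded_subset compact_eq_bounded_closed)
  moreover have "M \<noteq> {}" using z0 by (auto simp: M_def)
  ultimately obtain z1 where z1: "z1 \<in> M" "\<And>y. y \<in> M \<Longrightarrow> norm y \<le> norm z1"
    using continuous_attains_sup[of M norm] by (auto intro: continuous_intros)
  have "norm z1 = r"
  proof (rule ccontr)
    assume "norm z1 \<noteq> r"
    then have lt: "norm z1 < r" using z1 by (auto simp: M_def)
    define e where "e = r - norm z1"
    have sub: "ball z1 e \<subseteq> cball 0 r"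
    proof
      fix y assume "y \<in> ball z1 e"
      then show "y \<in> cball 0 r"
        using norm_triangle_ineq[of "y - z1" z1] by (auto simp: e_def dist_norm norm_minus_commute)
    qed
    have "\<exists>d>0. d \<le> e \<and> (\<forall>z\<in>ball z1 d. u z = u z1)"
      unfolding u_def
    proof (rule sum_powr_local_max)
      show "F k holomorphic_on ball z1 e" if "k \<in> K" for k
        using hol[OF that] sub S(2) by (meson holomorphic_on_subset subset_trans)
      show "(\<Sum>k\<in>K. norm (F k z) powr q) \<le> (\<Sum>k\<in>K. norm (F k z1) powr q)" if "z \<in> ball z1 e" for z
        using z0(2)[of z] sub that z1(1) by (auto simp: M_def u_def[symmetric])
    qed (use fin q lt in \<open>auto simp: e_def\<close>)
    then obtain d where d: "d > 0" "d \<le> e" "\<And>z. z \<in> ball z1 d \<Longrightarrow> u z = u z1" by blast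
    \<comment> \<open>The outward unit direction at \<open>z1\<close>; at the origin any direction
      serves.\<close>
    define v where "v = (if z1 = 0 then 1 else z1 / of_real (norm z1))"
    have v: "norm v = 1" "norm (z1 + of_real (d/2) * v) = norm z1 + d/2"
    proof -
      show "norm v = 1" by (simp add: v_def norm_divide)
      show "norm (z1 + of_real (d/2) * v) = norm z1 + d/2"
      proof (cases "z1 = 0")
        case True then show ?thesis using d by (simp add: v_def)
      next
        case False
        then have "z1 + of_real (d/2) * v = of_real (norm z1 + d/2) * (z1 / of_real (norm z1))"
          by (simp add: v_def field_simps)
        then show ?thesis using False d by (simp add: norm_mult norm_divide del: of_real_add)
      qed
    qed
    have *: "z1 + of_real (d/2) * v \<in> ball z1 d"
      using d v(1) by (simp add: dist_norm norm_mult)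
    moreover have "ball z1 d \<subseteq> cball 0 r" using sub d(2) by (meson order_trans subset_ball)
    ultimately have "z1 + of_real (d/2) * v \<in> cball 0 r" by (rule rev_subsetD)
    moreover have "u (z1 + of_real (d/2) * v) = u z0"
      using d(3)[OF *] z1(1) by (simp only: M_def mem_Collect_eq)
    ultimately have "z1 + of_real (d/2) * v \<in> M"
      by (simp only: M_def mem_Collect_eq conj_absorb simp_thms)
    from z1(2)[OF this] v(2) d(1) show False by simp
  qed
  moreover have "u z \<le> u z1" using z0(2)[of z] z z1 by (auto simp: M_def)
  ultimately show ?thesis by (auto simp: u_def)
qed

section \<open>Circle means through Riemann sums\<close>

text \<open>Riemann sums replace a circle mean by a finite sum, the only kind the maximum principle
  above handles. Each cell of length \<open>d\<close> contributes an error of at most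
  \<open>d * \<epsilon>\<close>, whence the induction on the number of cells.\<close>

lemma integral_riemann_sum:
  fixes h :: "real \<Rightarrow> real"
  assumes h: "continuous_on {0..d * real m} h" and d: "0 \<le> d"
    and osc: "\<And>s t. s \<in> {0..d * real m} \<Longrightarrow> t \<in> {0..d * real m} \<Longrightarrow> \<bar>s - t\<bar> \<le> d \<Longrightarrow> \<bar>h s - h t\<bar> \<le> \<epsilon>"
  shows "\<bar>integral {0..d * real m} h - d * (\<Sum>k<m. h (d * real k))\<bar> \<le> d * real m * \<epsilon>"
  using h osc
proof (induction m)
  case 0 then show ?case by simp
next
  case (Suc m)
  have le: "d * real m \<le> d * real (Suc m)" "0 \<le> d * real m" using d by (auto simp: algebra_simps)
  have IH: "\<bar>integral {0..d * real m} h - d * (\<Sum>k<m. h (d * real k))\<bar> \<le> d * real m * \<epsilon>"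
    using le by (intro Suc.IH continuous_on_subset[OF Suc.prems(1)] Suc.prems(2)) auto
  have int: "h integrable_on {0..d * real (Suc m)}"
    by (rule integrable_continuous_real[OF Suc.prems(1)])
  have comb: "integral {0..d * real (Suc m)} h = integral {0..d * real m} h + integral {d * real m..d * real (Suc m)} h"
    using Henstock_Kurzweil_Integration.integral_combine[OF le(2,1) int] by simp
  have int': "h integrable_on {d * real m..d * real (Suc m)}"
    using integrable_subinterval_real[OF int] le by auto
  have len: "d * real (Suc m) - d * real m = d" by (simp add: algebra_simps)
  have "\<bar>integral {d * real m..d * real (Suc m)} h - d * h (d * real m)\<bar> = \<bar>integral {d * real m..d * real (Suc m)} (\<lambda>t. h t - h (d * real m))\<bar>"
    using Henstock_Kurzweil_Integration.integral_diff[OF int' integrable_const_ivl, of "h (d * real m)"] len le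
    by (simp only: integral_const_real content_real real_scaleR_def)
  also have "\<dots> \<le> integral {d * real m..d * real (Suc m)} (\<lambda>t. \<epsilon>)"
    unfolding real_norm_def[symmetric]
  proof (rule integral_norm_bound_integral)
    show "norm (h t - h (d * real m)) \<le> \<epsilon>" if "t \<in> {d * real m..d * real (Suc m)}" for t
      using that le len d unfolding real_norm_def
      by (intro Suc.prems(2)) (auto intro: order_trans[OF le(2)])
  qed (use int' in \<open>auto intro!: Henstock_Kurzweil_Integration.integrable_diff\<close>)
  also have "\<dots> = d * \<epsilon>" using len le by simp
  finally show ?case using IH comb by (simp add: algebra_simps)
qed

lemma integral_periodic_shift:
  fixes h :: "real \<Rightarrow> real"
  assumes h: "continuous_on UNIV h" and per: "\<And>t. h (t + T) = h t" and s: "0 \<le> s" "s \<le> T"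
  shows "integral {0..T} (\<lambda>t. h (t + s)) = integral {0..T} h"
proof -
  have int: "h integrable_on {a..b}" for a b
    by (intro integrable_continuous_real continuous_on_subset[OF h]) auto
  have "integral {0..T} (\<lambda>t. h (t + s)) = integral {s..T+s} h"
    using integral_shift_real_ivl[of s s "T+s" h] by simp
  also have "\<dots> = integral {s..T} h + integral {T..T+s} h"
    using Henstock_Kurzweil_Integration.integral_combine[of s T "T+s" h] int s by simp
  also have "integral {T..T+s} h = integral {0..s} h"
    using integral_shift_real_ivl[of T T "T+s" h] per by simp
  also have "integral {s..T} h + integral {0..s} h = integral {0..T} h"
    using Henstock_Kurzweil_Integration.integral_combine[of 0 s T h] int s by simp
  finally show ?thesis .
qed

lemma circle_point_in_disc [simp]:
  assumes "0 \<le> r" "r < 1"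
  shows "of_real r * cis t \<in> unit_disc" "norm (of_real r * cis t) = r"
  using assms by (auto simp: norm_mult)

lemma continuous_on_circle_powr:
  assumes "continuous_on unit_disc F" "0 < q" "0 \<le> r" "r < 1"
  shows "continuous_on A (\<lambda>t. norm (F (of_real r * cis t)) powr q)"
proof -
  have "continuous_on A (\<lambda>t. F (of_real r * cis t))"
    by (rule continuous_on_compose2[OF assms(1)])
       (use assms in \<open>auto intro!: continuous_intros simp: norm_mult cis_conv_exp\<close>)
  then show ?thesis
    by (intro continuous_on_powr' continuous_intros) (use assms in auto)
qed

lemma norm_cis_diff_le: "norm (cis s - cis t) \<le> \<bar>s - t\<bar>"
proof -
  have "cis s - cis t = cis t * (exp (\<i> * of_real (s - t)) - 1)"
    by (simp add: cis_conv_exp right_diff_distrib exp_diff)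
  then have "norm (cis s - cis t) = 2 * \<bar>sin ((s - t) / 2)\<bar>"
    by (simp add: norm_mult dist_exp_i_1 del: of_real_diff)
  then show ?thesis using abs_sin_x_le_abs_x[of "(s - t) / 2"] by simp
qed

text \<open>The mean over a circle is nearly a sum of the powers |F_k|^q with F_k(z) = F(z cis(d
  k)), taken at a single point. The maximum principle moves that point from \<open>\<rho>\<close> to
  some \<open>\<zeta>\<close> of modulus \<open>r\<close>, and periodicity turns the sum at
  \<open>\<zeta>\<close> back into the mean over the outer circle.\<close>

lemma circle_mean_mono_radius:
  assumes hol: "F holomorphic_on unit_disc" and q: "0 < q" and r: "0 \<le> \<rho>" "\<rho> \<le> r" "r < 1"
  shows "circle_mean q F \<rho> \<le> circle_mean q F r"
proof (cases "r = 0")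
  case True then show ?thesis using r by simp
next
  case False
  then have r0: "0 < r" using r by auto
  have contF: "continuous_on unit_disc F" by (rule holomorphic_on_imp_continuous_on[OF hol])
  define g where "g z = norm (F z) powr q" for z
  have contg: "continuous_on (cball 0 r) g"
    unfolding g_def
    by (intro continuous_on_powr' continuous_intros continuous_on_subset[OF contF]) (use q r in auto)
  have uc: "uniformly_continuous_on (cball 0 r) g"
    by (rule compact_uniformly_continuous[OF contg]) auto
  have cirs: "continuous_on A (\<lambda>t. g (of_real x * cis (t + s)))" if "0 \<le> x" "x \<le> r" for x A s
    by (rule continuous_on_compose2[OF contg])
       (use that in \<open>auto intro!: continuous_intros simp: norm_mult cis_conv_exp\<close>)
  show ?thesis
  proof (rule field_le_epsilon)
    fix e :: real assume "0 < e"
    \<comment> \<open>The Riemann error is paid twice, once on each circle.\<close>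
    define \<epsilon> where "\<epsilon> = e / 2"
    have \<epsilon>: "0 < \<epsilon>" using \<open>0 < e\<close> by (simp add: \<epsilon>_def)
    \<comment> \<open>Uniform continuity on the closed disc gives a mesh that works for both radii
      and every rotation \<open>s\<close>; this matters because \<open>\<zeta>\<close>, and with it
      the rotation, depends on the mesh.\<close>
    obtain \<delta> where \<delta>: "\<delta> > 0"
      "\<And>x y. x \<in> cball 0 r \<Longrightarrow> y \<in> cball 0 r \<Longrightarrow> dist y x < \<delta> \<Longrightarrow> dist (g y) (g x) < \<epsilon>"
      using uc \<epsilon> unfolding uniformly_continuous_on_def by metis
    obtain n :: nat where n: "2 * pi / \<delta> < real n" using reals_Archimedean2 by blast
    have n0: "0 < n" using n \<delta>(1) by (metis divide_pos_pos mult_pos_pos gr0I less_asym of_nat_0 pi_gt_zero zero_less_numeral)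
    define d where "d = 2 * pi / n"
    have d: "0 < d" "d < \<delta>" "d * real n = 2 * pi"
      using n n0 \<delta>(1) by (auto simp: d_def field_simps)
    have osc: "\<bar>g (of_real x * cis (t + s)) - g (of_real x * cis (t' + s))\<bar> \<le> \<epsilon>"
      if "\<bar>t - t'\<bar> \<le> d" "0 \<le> x" "x \<le> r" for x s t t'
    proof -
      have "norm (cis (t + s) - cis (t' + s)) \<le> \<bar>t - t'\<bar>"
        using norm_cis_diff_le[of "t + s" "t' + s"] by simp
      then have "dist (of_real x * cis (t + s)) (of_real x * cis (t' + s)) \<le> x * \<bar>t - t'\<bar>"
        using that by (simp add: dist_norm right_diff_distrib[symmetric] norm_mult mult_left_mono)
      also have "\<dots> \<le> 1 * d" using that r by (intro mult_mono) auto
      finally have "dist (of_real x * cis (t + s)) (of_real x * cis (t' + s)) < \<delta>" using d by simp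
      from \<delta>(2)[OF _ _ this] that show ?thesis by (simp add: norm_mult dist_real_def)
    qed
    have riem: "\<bar>integral {0..2*pi} (\<lambda>t. g (of_real x * cis (t + s))) - d * (\<Sum>k<n. g (of_real x * cis (d * real k + s)))\<bar> \<le> 2 * pi * \<epsilon>"
      if "0 \<le> x" "x \<le> r" for x s
      using integral_riemann_sum[of d n "\<lambda>t. g (of_real x * cis (t + s))" \<epsilon>] d cirs[OF that] osc that
      by simp
    have rot: "integral {0..2*pi} (\<lambda>t. g (of_real x * cis (t + s))) = 2 * pi * circle_mean q F x"
      if "0 \<le> x" "x \<le> r" "0 \<le> s" "s \<le> 2 * pi" for x s
      using integral_periodic_shift[of "\<lambda>t. g (of_real x * cis t)" "2*pi" s] cirs[of x UNIV 0] that
      by (simp add: circle_mean_def g_def cis_mult[symmetric])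
    obtain \<zeta> where \<zeta>: "norm \<zeta> = r"
      "(\<Sum>k<n. g (of_real \<rho> * cis (d * real k))) \<le> (\<Sum>k<n. g (\<zeta> * cis (d * real k)))"
    proof -
      have "\<exists>\<zeta>. norm \<zeta> = r \<and> (\<Sum>k<n. norm (F (of_real \<rho> * cis (d * real k))) powr q) \<le> (\<Sum>k<n. norm (F (\<zeta> * cis (d * real k))) powr q)"
      proof (rule sum_powr_max_principle[where F = "\<lambda>k z. F (z * cis (d * real k))" and S = unit_disc])
        show "(\<lambda>z. F (z * cis (d * real k))) holomorphic_on unit_disc" for k
          by (rule holomorphic_on_compose_gen[OF _ hol, unfolded o_def])
             (auto intro!: holomorphic_intros simp: norm_mult)
      qed (use r r0 q in auto)
      then show ?thesis using that by (auto simp: g_def)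
    qed
    define s where "s = Arg2pi \<zeta>"
    have s: "0 \<le> s" "s \<le> 2 * pi" "\<zeta> = of_real r * cis s"
      using Arg2pi[of \<zeta>] \<zeta>(1) by (auto simp: s_def cis_conv_exp is_Arg_def)
    have "2 * pi * circle_mean q F \<rho> \<le> d * (\<Sum>k<n. g (of_real \<rho> * cis (d * real k))) + 2 * pi * \<epsilon>"
      using riem[of \<rho> 0] rot[of \<rho> 0] r by simp
    also have "\<dots> \<le> d * (\<Sum>k<n. g (\<zeta> * cis (d * real k))) + 2 * pi * \<epsilon>"
      using \<zeta>(2) d by simp
    also have "\<dots> \<le> 2 * pi * circle_mean q F r + 2 * pi * \<epsilon> + 2 * pi * \<epsilon>"
      using riem[of r s] rot[of r s] r s by (simp add: s(3) mult.assoc cis_mult add.commute)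
    also have "\<dots> = 2 * pi * (circle_mean q F r + e)"
      by (simp add: \<epsilon>_def algebra_simps)
    finally show "circle_mean q F \<rho> \<le> circle_mean q F r + e" by simp
  qed
qed

section \<open>Hardy spaces and dilations\<close>

text \<open>For an arbitrary \<open>f\<close> the integrand may fail to be integrable; the integral
  then has the default value 0.\<close>

lemma circle_mean_nonneg: "0 \<le> circle_mean p f r"
  unfolding circle_mean_def
  by (cases "(\<lambda>t. norm (f (of_real r * cis t)) powr p) integrable_on {0..2 * pi}")
     (auto intro!: divide_nonneg_pos Henstock_Kurzweil_Integration.integral_nonneg simp: not_integrable_integral)

lemma circle_mean_const: "circle_mean p (\<lambda>z. c) r = norm c powr p"
  by (simp add: circle_mean_def)

lemma circle_mean_dilate: "circle_mean p (\<lambda>z. f (of_real \<rho> * z)) r = circle_mean p f (\<rho> * r)"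
  by (simp add: circle_mean_def mult.assoc)

lemma circle_mean_has_integral:
  assumes "continuous_on unit_disc F" "0 < q" "0 \<le> r" "r < 1"
  shows "((\<lambda>t. norm (F (of_real r * cis t)) powr q) has_integral (2 * pi * circle_mean q F r)) {0..2 * pi}"
  using integrable_integral[OF integrable_continuous_real[OF continuous_on_circle_powr[OF assms]]]
  by (simp add: circle_mean_def)

lemma circle_mean_le_lincomb:
  assumes "continuous_on unit_disc f" "continuous_on unit_disc g" "continuous_on unit_disc h"
    and p: "0 < p" and r: "0 \<le> r" "r < 1"
    and le: "\<And>z. norm z = r \<Longrightarrow> norm (f z) powr p \<le> a * norm (g z) powr p + b * norm (h z) powr p"
  shows "circle_mean p f r \<le> a * circle_mean p g r + b * circle_mean p h r"
proof -
  have "2 * pi * circle_mean p f r \<le> a * (2 * pi * circle_mean p g r) + b * (2 * pi * circle_mean p h r)"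
    by (rule has_integral_le[OF circle_mean_has_integral
        has_integral_add[OF has_integral_mult_right has_integral_mult_right]])
       (use assms in \<open>auto intro!: circle_mean_has_integral le\<close>)
  also have "\<dots> = 2 * pi * (a * circle_mean p g r + b * circle_mean p h r)"
    by (simp add: algebra_simps)
  finally show ?thesis by simp
qed

text \<open>Bounding the sum by twice the larger summand gives a constant valid for every p \<ge> 0.
  It only serves to keep means bounded, where the size of the constant is immaterial.\<close>

lemma norm_add_powr_le:
  fixes a b :: "'a :: real_normed_vector"
  assumes "0 \<le> p"
  shows "norm (a + b) powr p \<le> 2 powr p * norm a powr p + 2 powr p * norm b powr p"
proof -
  have "norm (a + b) powr p \<le> (2 * max (norm a) (norm b)) powr p"
    using norm_triangle_ineq[of a b] by (intro powr_mono2 assms) auto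
  also have "\<dots> = 2 powr p * max (norm a) (norm b) powr p" by (simp add: powr_mult)
  also have "\<dots> \<le> 2 powr p * (norm a powr p + norm b powr p)"
    by (intro mult_left_mono) (auto simp: max_def)
  finally show ?thesis by (simp add: algebra_simps)
qed

lemma hardyI:
  assumes "f holomorphic_on unit_disc" "\<And>r. 0 \<le> r \<Longrightarrow> r < 1 \<Longrightarrow> circle_mean p f r \<le> B"
  shows "f \<in> hardy p"
  using assms by (auto simp: hardy_def intro!: bdd_aboveI2)

lemma hardy_holomorphic: "f \<in> hardy p \<Longrightarrow> f holomorphic_on unit_disc"
  by (simp add: hardy_def)

lemma hardy_continuous: "f \<in> hardy p \<Longrightarrow> continuous_on unit_disc f"
  by (simp add: hardy_def holomorphic_on_imp_continuous_on)

lemma hardy_bound: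
  assumes "f \<in> hardy p"
  obtains B where "0 \<le> B" "\<And>r. 0 \<le> r \<Longrightarrow> r < 1 \<Longrightarrow> circle_mean p f r \<le> B"
proof -
  obtain B where "\<forall>r\<in>{0..<1}. circle_mean p f r \<le> B"
    using assms unfolding hardy_def bdd_above_def by auto
  then have B: "\<And>r. 0 \<le> r \<Longrightarrow> r < 1 \<Longrightarrow> circle_mean p f r \<le> B" by simp
  then show ?thesis
    using that[of B] circle_mean_nonneg[of p f 0] by force
qed

lemma hardy_lincomb_bound:
  assumes "f holomorphic_on unit_disc" "g \<in> hardy p" "h \<in> hardy p" "0 < p" "0 \<le> a" "0 \<le> b"
    and le: "\<And>z. z \<in> unit_disc \<Longrightarrow> norm (f z) powr p \<le> a * norm (g z) powr p + b * norm (h z) powr p"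
  shows "f \<in> hardy p"
proof -
  obtain B where B: "\<And>r. 0 \<le> r \<Longrightarrow> r < 1 \<Longrightarrow> circle_mean p g r \<le> B" using hardy_bound[OF assms(2)] by blast
  obtain B' where B': "\<And>r. 0 \<le> r \<Longrightarrow> r < 1 \<Longrightarrow> circle_mean p h r \<le> B'" using hardy_bound[OF assms(3)] by blast
  show ?thesis
  proof (rule hardyI[OF assms(1)])
    fix r :: real assume r: "0 \<le> r" "r < 1"
    have "circle_mean p f r \<le> a * circle_mean p g r + b * circle_mean p h r"
      using assms r by (intro circle_mean_le_lincomb) (auto intro: holomorphic_on_imp_continuous_on hardy_continuous)
    also have "\<dots> \<le> a * B + b * B'"
      using B[OF r] B'[OF r] assms by (intro add_mono mult_left_mono)
    finally show "circle_mean p f r \<le> a * B + b * B'" .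
  qed
qed

lemma hardy_const: "(\<lambda>z. c) \<in> hardy p"
  by (rule hardyI[where B = "norm c powr p"]) (auto simp: circle_mean_const)

lemma hardy_add:
  assumes "f \<in> hardy p" "g \<in> hardy p" "0 < p"
  shows "(\<lambda>z. f z + g z) \<in> hardy p"
  by (rule hardy_lincomb_bound[where a = "2 powr p" and b = "2 powr p", OF _ assms(1,2)])
     (use assms assms(1,2)[THEN hardy_holomorphic] in \<open>auto intro!: holomorphic_intros norm_add_powr_le\<close>)

lemma hardy_mult_bounded:
  assumes "f \<in> hardy p" "h holomorphic_on unit_disc" "\<And>z. z \<in> unit_disc \<Longrightarrow> norm (h z) \<le> B" "0 < p"
  shows "(\<lambda>z. f z * h z) \<in> hardy p"
proof (rule hardy_lincomb_bound[where a = "B powr p" and b = 0, OF _ assms(1) assms(1)])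
  fix z :: complex assume z: "z \<in> unit_disc"
  have "norm (h z) powr p \<le> B powr p" using assms(3)[OF z] assms(4) by (intro powr_mono2) auto
  then show "norm (f z * h z) powr p \<le> B powr p * norm (f z) powr p + 0 * norm (f z) powr p"
    by (simp add: norm_mult powr_mult mult.commute[of "norm (h z) powr p"] mult_left_mono mult.commute[of "B powr p"])
qed (use assms assms(1)[THEN hardy_holomorphic] in \<open>auto intro!: holomorphic_intros\<close>)

lemma hardy_cmult:
  assumes "f \<in> hardy p" "0 < p"
  shows "(\<lambda>z. c * f z) \<in> hardy p"
  using hardy_mult_bounded[OF assms(1), of "\<lambda>_. c" "norm c"] assms(2) by (simp add: mult.commute)

lemma hardy_diff:
  assumes "f \<in> hardy p" "g \<in> hardy p" "0 < p"
  shows "(\<lambda>z. f z - g z) \<in> hardy p"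
  using hardy_add[OF assms(1) hardy_cmult[OF assms(2,3), of "-1"] assms(3)] by simp

lemma hardy_bounded:
  assumes "h holomorphic_on unit_disc" "\<And>z. z \<in> unit_disc \<Longrightarrow> norm (h z) \<le> B" "0 < p"
  shows "h \<in> hardy p"
  using hardy_mult_bounded[OF hardy_const[of 1] assms] by simp

section \<open>Convexity defects and convergence of dilations\<close>

lemma convex_midpoint_powr:
  fixes u v p :: real
  assumes "1 \<le> p" "0 \<le> u" "0 \<le> v"
  shows "2 * ((u + v) / 2) powr p \<le> u powr p + v powr p"
proof -
  \<comment> \<open>Convexity of the power is applied to positive arguments only; this covers the
    case of a zero argument.\<close>
  have half: "2 * (x / 2) powr p \<le> x powr p" if "0 \<le> x" for x :: real
  proof -
    have "2 powr 1 \<le> 2 powr p" using assms by (intro powr_mono) auto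
    then have "2 / 2 powr p \<le> (1::real)" by (simp add: field_simps)
    then have "x powr p * (2 / 2 powr p) \<le> x powr p * 1" by (intro mult_left_mono) auto
    then show ?thesis using that by (simp add: powr_divide mult.commute)
  qed
  consider "u = 0" | "v = 0" | "0 < u" "0 < v" using assms by fastforce
  then show ?thesis
  proof cases
    case 3
    have "((1 - 1/2) *\<^sub>R u + (1/2) *\<^sub>R v) powr p \<le> (1 - 1/2) * u powr p + (1/2) * v powr p"
      by (rule convex_onD[OF powr_convex[OF assms(1)]]) (use 3 in auto)
    moreover have *: "(1 - 1/2) *\<^sub>R u + (1/2) *\<^sub>R v = (u + v) / 2" by (simp add: field_simps)
    ultimately show ?thesis unfolding * by simp
  qed (use half assms in auto)
qed

lemma powr_inject_nonneg:
  fixes x y a :: real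
  assumes "x powr a = y powr a" "0 \<le> x" "0 \<le> y" "a \<noteq> 0"
  shows "x = y"
proof -
  have "(x powr a) powr (1 / a) = (y powr a) powr (1 / a)" using assms by simp
  then show ?thesis using assms(2-4) by (simp add: powr_powr)
qed

text \<open>The first defect, that of the geometric mean, controls the difference of the moduli; the second
  one, that of the arithmetic mean, then controls the arguments.\<close>

lemma norm_diff_powr_le_defects:
  fixes p \<eta> :: real
  assumes p: "1 \<le> p" and \<eta>: "0 < \<eta>"
  shows "\<exists>C>0. \<forall>a b :: complex. norm (a - b) powr p \<le> \<eta> * (norm a powr p + norm b powr p) +
     C * ((norm a powr p + norm b powr p - 2 * norm (a * b) powr (p/2)) +
          (norm a powr p + norm b powr p - 2 * norm ((a + b) / 2) powr p))"
proof -
  define s where "s x = norm (fst x) powr p + norm (snd x) powr p" for x :: "complex \<times> complex"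
  define D1 where "D1 x = s x - 2 * norm (fst x * snd x) powr (p/2)" for x
  \<comment> \<open>For p = 1 this defect vanishes on every pair lying on a common ray, so it
    separates points only together with \<open>D1\<close>.\<close>
  define D2 where "D2 x = s x - 2 * norm ((fst x + snd x) / 2) powr p" for x
  define df where "df x = norm (fst x - snd x) powr p" for x :: "complex \<times> complex"
  have D1: "D1 x = (norm (fst x) powr (p/2) - norm (snd x) powr (p/2))\<^sup>2" for x
  proof -
    have sq: "(norm a powr (p/2))\<^sup>2 = norm a powr p" for a :: complex
      by (simp add: power2_eq_square flip: powr_add)
    show ?thesis
      by (simp add: D1_def s_def power2_diff norm_mult powr_mult sq)
  qed
  have D2: "0 \<le> D2 x" for x
  proof -
    have "norm ((fst x + snd x) / 2) \<le> (norm (fst x) + norm (snd x)) / 2"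
      using norm_triangle_ineq[of "fst x" "snd x"] by (simp add: norm_divide)
    then have "norm ((fst x + snd x) / 2) powr p \<le> ((norm (fst x) + norm (snd x)) / 2) powr p"
      using p by (intro powr_mono2) auto
    then show ?thesis
      using convex_midpoint_powr[OF p, of "norm (fst x)" "norm (snd x)"] by (simp add: D2_def s_def)
  qed
  have D_eq: "fst x = snd x" if "D1 x + D2 x = 0" for x
  proof -
    have "D1 x = 0" "D2 x = 0" using that D1[of x] D2[of x] by (auto simp: add_nonneg_eq_0_iff)
    from \<open>D1 x = 0\<close> D1 have "norm (fst x) powr (p/2) = norm (snd x) powr (p/2)" by simp
    then have eq: "norm (fst x) = norm (snd x)" using p by (elim powr_inject_nonneg) auto
    from \<open>D2 x = 0\<close> have "norm ((fst x + snd x) / 2) powr p = norm (fst x) powr p"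
      by (simp add: D2_def s_def eq)
    then have "norm ((fst x + snd x) / 2) = norm (fst x)" using p by (elim powr_inject_nonneg) auto
    then have "norm (fst x + snd x) = 2 * norm (fst x)" by (simp add: norm_divide)
    \<comment> \<open>Both expressions for the inner product, through the norm of the sum and of the
      difference, are compared: equal moduli and a sum of full length leave no difference.\<close>
    then have "(norm (fst x - snd x))\<^sup>2 = 0"
      using eq dot_norm[of "fst x" "snd x"] dot_norm_neg[of "fst x" "snd x"] by (simp add: power2_eq_square)
    then show ?thesis by simp
  qed
  \<comment> \<open>All four quantities are homogeneous of degree p, which reduces the inequality to
    the compact unit sphere of pairs.\<close>
  have scale: "s (t *\<^sub>R x) = t powr p * s x" "D1 (t *\<^sub>R x) = t powr p * D1 x" "D2 (t *\<^sub>R x) = t powr p * D2 x"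
     "df (t *\<^sub>R x) = t powr p * df x" if "0 < t" for t x
  proof -
    show s: "s (t *\<^sub>R x) = t powr p * s x" using that by (simp add: s_def powr_mult distrib_left)
    have "norm (t *\<^sub>R fst x) powr (p/2) = t powr (p/2) * norm (fst x) powr (p/2)" 
         "norm (t *\<^sub>R snd x) powr (p/2) = t powr (p/2) * norm (snd x) powr (p/2)"
      using that by (simp_all add: powr_mult)
    then show "D1 (t *\<^sub>R x) = t powr p * D1 x"
      using that by (simp add: D1 power_mult_distrib right_diff_distrib[symmetric] power2_eq_square powr_add[symmetric])
    have "(fst (t *\<^sub>R x) + snd (t *\<^sub>R x)) / 2 = t *\<^sub>R ((fst x + snd x) / 2)"
      by (simp add: scaleR_conv_of_real field_simps)
    then have "norm ((fst (t *\<^sub>R x) + snd (t *\<^sub>R x)) / 2) powr p = t powr p * norm ((fst x + snd x) / 2) powr p"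
      using that by (simp only: norm_scaleR powr_mult abs_of_pos)
    then show "D2 (t *\<^sub>R x) = t powr p * D2 x" by (simp add: D2_def s right_diff_distrib)
    have "fst (t *\<^sub>R x) - snd (t *\<^sub>R x) = t *\<^sub>R (fst x - snd x)" by (simp add: scaleR_diff_right)
    then show "df (t *\<^sub>R x) = t powr p * df x"
      using that by (simp only: df_def norm_scaleR powr_mult abs_of_pos)
  qed
  have cs: "continuous_on A s" for A
    unfolding s_def by (intro continuous_intros continuous_on_powr') (use p in auto)
  have cD: "continuous_on A (\<lambda>x. D1 x + D2 x)" for A
    unfolding D1_def D2_def by (intro continuous_intros cs continuous_on_powr') (use p in auto)
  have cdf: "continuous_on A df" for A
    unfolding df_def by (intro continuous_intros continuous_on_powr') (use p in auto)
  \<comment> \<open>The part of the sphere where the term with \<open>\<eta>\<close> alone does not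
    strictly dominate. The diagonal misses it, so the total defect has a positive minimum
    \<open>m\<close> on \<open>T\<close>.\<close>
  define T where "T = sphere 0 1 \<inter> {x. \<eta> * s x \<le> df x}"
  have "closed {x. \<eta> * s x \<le> df x}"
    by (intro closed_Collect_le continuous_intros cs cdf)
  then have T: "compact T" unfolding T_def by (intro compact_Int_closed compact_sphere)
  have pos: "0 < D1 x + D2 x" if "x \<in> T" for x
  proof -
    have "D1 x + D2 x \<noteq> 0"
    proof
      assume "D1 x + D2 x = 0"
      from D_eq[OF this] have eq: "fst x = snd x" .
      then have "\<eta> * s x \<le> 0" using that p by (simp add: T_def df_def)
      then have "s x \<le> 0" using \<eta> by (simp add: mult_le_0_iff)
      then have "norm (fst x) powr p = 0" using eq by (simp add: s_def powr_ge_zero order_antisym)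
      then have "x = 0" using eq by (simp add: prod_eq_iff)
      then show False using that by (simp add: T_def)
    qed
    then show ?thesis using D1[of x] D2[of x] by (simp add: order_less_le)
  qed
  have "\<exists>m>0. \<forall>x\<in>T. m \<le> D1 x + D2 x"
  proof (cases "T = {}")
    case True then show ?thesis by (intro exI[of _ 1]) auto
  next
    case False
    from continuous_attains_inf[OF T False cD] pos show ?thesis by blast
  qed
  then obtain m where m: "m > 0" "\<And>x. x \<in> T \<Longrightarrow> m \<le> D1 x + D2 x" by blast
  \<comment> \<open>On the unit sphere both components have norm at most 1, so \<open>df\<close> is
    at most \<open>2 powr p\<close>, while the total defect is at least \<open>m\<close> on
    \<open>T\<close>.\<close>
  define C where "C = 2 powr p / m"
  have C: "C > 0" using m by (simp add: C_def)
  have D0: "0 \<le> D1 x + D2 x" for x using D1[of x] D2[of x] by simp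
  have s0: "0 \<le> s x" for x by (simp add: s_def)
  have unit: "df x \<le> \<eta> * s x + C * (D1 x + D2 x)" if x: "norm x = 1" for x
  proof (cases "x \<in> T")
    case True
    have "norm (fst x - snd x) \<le> norm (fst x) + norm (snd x)" by (rule norm_triangle_ineq4)
    also have "\<dots> \<le> 2" using norm_fst_le[of "fst x" "snd x"] norm_snd_le[of "snd x" "fst x"] x by simp
    finally have "df x \<le> 2 powr p" unfolding df_def using p by (intro powr_mono2) auto
    also have "\<dots> = C * m" using m by (simp add: C_def)
    also have "\<dots> \<le> C * (D1 x + D2 x)" using C m(2)[OF True] by simp
    finally show ?thesis using s0[of x] \<eta> by (simp add: add_increasing)
  next
    case False
    then have "df x \<le> \<eta> * s x" using x by (simp add: T_def)
    then show ?thesis using C D0[of x] by (simp add: add_increasing2)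
  qed
  have "df x \<le> \<eta> * s x + C * (D1 x + D2 x)" for x
  proof (cases "x = 0")
    case True then show ?thesis using p by (simp add: df_def s_def D1_def D2_def)
  next
    case False
    define y where "y = (1 / norm x) *\<^sub>R x"
    have y: "norm y = 1" "x = norm x *\<^sub>R y" using False by (simp_all add: y_def)
    have nx: "0 < norm x" using False by simp
    have "norm x powr p * df y \<le> norm x powr p * (\<eta> * s y + C * (D1 y + D2 y))"
      using unit[OF y(1)] by (rule mult_left_mono) simp
    then have "df (norm x *\<^sub>R y) \<le> \<eta> * s (norm x *\<^sub>R y) + C * (D1 (norm x *\<^sub>R y) + D2 (norm x *\<^sub>R y))"
      unfolding scale[OF nx] by (simp add: algebra_simps)
    then show ?thesis using y(2) by simp
  qed
  then show ?thesis using C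
    by (intro exI[of _ C]) (auto simp: df_def s_def D1_def D2_def dest: spec[of _ "(_, _)"])
qed

lemma dilate_holomorphic:
  assumes hol: "f holomorphic_on unit_disc" and \<rho>: "0 \<le> \<rho>" "\<rho> \<le> 1"
  shows "(\<lambda>z. f (of_real \<rho> * z)) holomorphic_on unit_disc"
proof (rule holomorphic_on_compose_gen[OF _ hol, unfolded o_def])
  show "(*) (of_real \<rho>) ` unit_disc \<subseteq> unit_disc"
  proof
    fix y assume "y \<in> (*) (complex_of_real \<rho>) ` unit_disc"
    then obtain z where z: "y = of_real \<rho> * z" "norm z < 1" by force
    have "\<rho> * norm z \<le> norm z" using \<rho> by (intro mult_left_le_one_le) auto
    then show "y \<in> unit_disc" using z \<rho> by (simp add: norm_mult)
  qed
qed (auto intro!: holomorphic_intros)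

text \<open>For \<open>r\<close> close to 1 the functions \<open>f(z)\<close> and \<open>f(\<rho>z)\<close> on the circle of radius \<open>r\<close> have small
  defects in the sense of the preceding lemma: the means of \<open>f(z) f(\<rho>z)\<close> and \<open>(f(z) + f(\<rho>z))/2\<close>
  increase with the radius, and at a fixed radius they converge to the mean of \<open>f\<close> as \<open>\<rho>\<close> tends to 1.\<close>

lemma hardy_dilation_tendsto:
  assumes f: "f \<in> hardy p" and p: "1 \<le> p" and e: "0 < e"
  shows "\<exists>\<rho>0. 0 \<le> \<rho>0 \<and> \<rho>0 < 1 \<and> (\<forall>\<rho> r. \<rho>0 < \<rho> \<longrightarrow> \<rho> < 1 \<longrightarrow> 0 \<le> r \<longrightarrow> r < 1 \<longrightarrow>
           circle_mean p (\<lambda>z. f z - f (of_real \<rho> * z)) r \<le> e)"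
proof -
  have hol: "f holomorphic_on unit_disc" and cont: "continuous_on unit_disc f"
    using f by (auto intro: hardy_holomorphic hardy_continuous)
  define M where "M r = circle_mean p f r" for r
  define N where "N = (SUP r\<in>{0..<1}. M r)"
  have bdd: "bdd_above (M ` {0..<1})" using f by (simp add: hardy_def M_def)
  have MN: "M r \<le> N" if "0 \<le> r" "r < 1" for r
    unfolding N_def using that by (intro cSUP_upper bdd) auto
  have N0: "0 \<le> N" using MN[of 0] circle_mean_nonneg[of p f 0] by (simp add: M_def)
  \<comment> \<open>Makes the term \<eta>(N + N) at most e/2; adding 1 covers N = 0.\<close>
  define \<eta> where "\<eta> = e / (4 * (N + 1))"
  have \<eta>: "0 < \<eta>" "2 * \<eta> * N \<le> e / 2" using e N0 by (auto simp: \<eta>_def field_simps)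
  obtain C where C: "C > 0" "\<And>a b :: complex. norm (a - b) powr p \<le> \<eta> * (norm a powr p + norm b powr p) +
     C * ((norm a powr p + norm b powr p - 2 * norm (a * b) powr (p/2)) +
          (norm a powr p + norm b powr p - 2 * norm ((a + b) / 2) powr p))"
    using norm_diff_powr_le_defects[OF p \<eta>(1)] by blast
  \<comment> \<open>Each of the two defects will be at most N + N - 2(N - 2\<delta>) = 4\<delta>, so
    together they contribute 8C\<delta> = e/2.\<close>
  define \<delta> where "\<delta> = e / (16 * C)"
  have \<delta>: "0 < \<delta>" using e C by (simp add: \<delta>_def)
  obtain r0 where r0: "0 \<le> r0" "r0 < 1" "N - \<delta> < M r0"
  proof -
    have "\<exists>x\<in>{0..<1}. N - \<delta> < M x" using \<delta> unfolding N_def 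
      by (subst less_cSUP_iff[symmetric, OF _ bdd]) auto
    then show ?thesis using that by auto
  qed
  \<comment> \<open>\<open>H\<close> stands for the product (with q = p/2) or the midpoint (with q =
    p). In both cases the mean at \<rho> = 1 is \<open>M r0\<close>, which exceeds N - \<delta>, and
    the integral over the fixed circle of radius \<open>r0\<close> depends continuously on
    \<rho>.\<close>
  have near: "\<exists>\<rho>1<1. \<forall>\<rho>. \<rho>1 < \<rho> \<longrightarrow> \<rho> < 1 \<longrightarrow> N - 2 * \<delta> < circle_mean q (\<lambda>z. H (f z) (f (of_real \<rho> * z))) r0"
    if H: "continuous_on UNIV (\<lambda>x. H (fst x) (snd x))" "\<And>a. norm (H a a) powr q = norm a powr p" and q: "0 < q"
    for H :: "complex \<Rightarrow> complex \<Rightarrow> complex" and q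
  proof -
    define J where "J x = integral (cbox 0 (2*pi)) (\<lambda>t. norm (H (f (of_real r0 * cis t)) (f (of_real x * (of_real r0 * cis t)))) powr q)" for x
    have in_disc: "of_real x * (of_real r0 * cis t) \<in> unit_disc" if "0 \<le> x" "x \<le> 1" for x t
      using that r0 by (auto simp: norm_mult intro: le_less_trans[OF mult_left_le_one_le])
    have c1: "continuous_on ({0..1} \<times> cbox 0 (2*pi)) (\<lambda>y. f (of_real r0 * cis (snd y)))"
      by (rule continuous_on_compose2[OF cont])
         (use r0 in \<open>auto intro!: continuous_intros simp: norm_mult cis_conv_exp\<close>)
    have c2: "continuous_on ({0..1} \<times> cbox 0 (2*pi)) (\<lambda>y. f (of_real (fst y) * (of_real r0 * cis (snd y))))"
    proof (rule continuous_on_compose2[OF cont])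
      show "continuous_on ({0..1} \<times> cbox 0 (2*pi)) (\<lambda>y :: real \<times> real. of_real (fst y) * (of_real r0 * cis (snd y)) :: complex)"
        by (auto intro!: continuous_intros simp: cis_conv_exp)
      show "(\<lambda>y :: real \<times> real. of_real (fst y) * (of_real r0 * cis (snd y))) ` ({0..1} \<times> cbox 0 (2*pi)) \<subseteq> unit_disc"
        using in_disc by auto
    qed
    have c3: "continuous_on ({0..1} \<times> cbox 0 (2*pi)) (\<lambda>y. H (f (of_real r0 * cis (snd y))) (f (of_real (fst y) * (of_real r0 * cis (snd y)))))"
      using continuous_on_compose2[OF H(1) continuous_on_Pair[OF c1 c2]] by simp
    have "continuous_on {0..1} J"
      unfolding J_def
    proof (rule integral_continuous_on_param)
      show "continuous_on ({0..1} \<times> cbox 0 (2*pi))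
        (\<lambda>(x, t). norm (H (f (of_real r0 * cis t)) (f (of_real x * (of_real r0 * cis t)))) powr q)"
        unfolding case_prod_unfold
        by (intro continuous_on_powr' continuous_intros c3) (use q in auto)
    qed
    moreover have J: "circle_mean q (\<lambda>z. H (f z) (f (of_real x * z))) r0 = J x / (2 * pi)" for x
      by (simp add: J_def circle_mean_def)
    moreover have "J 1 / (2 * pi) = M r0" using H(2) by (simp add: J_def M_def circle_mean_def)
    ultimately have "((\<lambda>x. J x / (2 * pi)) \<longlongrightarrow> M r0) (at 1 within {0..1})"
      by (auto simp: continuous_on_def intro!: tendsto_eq_intros)
    moreover have "N - 2 * \<delta> < M r0" using r0(3) \<delta> by simp
    ultimately have "eventually (\<lambda>x. N - 2 * \<delta> < J x / (2 * pi)) (at 1 within {0..1})"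
      by (rule order_tendstoD(1))
    then obtain d where d: "d > 0" "\<And>x. x \<in> {0..1} \<Longrightarrow> x \<noteq> 1 \<Longrightarrow> dist x 1 < d \<Longrightarrow> N - 2 * \<delta> < J x / (2 * pi)"
      by (auto simp: eventually_at)
    have "N - 2 * \<delta> < J \<rho> / (2 * pi)" if "max 0 (1 - d) < \<rho>" "\<rho> < 1" for \<rho>
      using that by (intro d(2)) (auto simp: dist_real_def)
    then show ?thesis unfolding J using d(1) by (intro exI[of _ "max 0 (1 - d)"]) auto
  qed
  have self: "norm (a * a) powr (p/2) = norm a powr p" for a :: complex
    by (simp add: norm_mult powr_mult flip: powr_add)
  obtain \<rho>1 where \<rho>1: "\<rho>1 < 1" "\<And>\<rho>. \<rho>1 < \<rho> \<Longrightarrow> \<rho> < 1 \<Longrightarrow> N - 2 * \<delta> < circle_mean (p/2) (\<lambda>z. f z * f (of_real \<rho> * z)) r0"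
  proof -
    have "\<exists>\<rho>1<1. \<forall>\<rho>. \<rho>1 < \<rho> \<longrightarrow> \<rho> < 1 \<longrightarrow> N - 2 * \<delta> < circle_mean (p/2) (\<lambda>z. f z * f (of_real \<rho> * z)) r0"
      by (rule near) (use p self in \<open>auto intro!: continuous_intros\<close>)
    then show ?thesis using that by blast
  qed
  obtain \<rho>2 where \<rho>2: "\<rho>2 < 1" "\<And>\<rho>. \<rho>2 < \<rho> \<Longrightarrow> \<rho> < 1 \<Longrightarrow> N - 2 * \<delta> < circle_mean p (\<lambda>z. (f z + f (of_real \<rho> * z)) / 2) r0"
  proof -
    have "\<exists>\<rho>1<1. \<forall>\<rho>. \<rho>1 < \<rho> \<longrightarrow> \<rho> < 1 \<longrightarrow> N - 2 * \<delta> < circle_mean p (\<lambda>z. (f z + f (of_real \<rho> * z)) / 2) r0"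
      by (rule near) (use p in \<open>auto intro!: continuous_intros\<close>)
    then show ?thesis using that by blast
  qed
  show ?thesis
  proof (intro exI[of _ "max 0 (max \<rho>1 \<rho>2)"] conjI allI impI)
    fix \<rho> r :: real
    assume \<rho>: "max 0 (max \<rho>1 \<rho>2) < \<rho>" "\<rho> < 1" and r: "0 \<le> r" "r < 1"
    have hg: "(\<lambda>z. f (of_real \<rho> * z)) holomorphic_on unit_disc" using hol \<rho> by (intro dilate_holomorphic) auto
    \<comment> \<open>The threshold for \<rho> must not depend on \<open>r\<close>. The lower bounds
      known at \<open>r0\<close> pass up to \<open>r'\<close> by monotonicity of the means, and the
      resulting estimate for the difference passes back down to \<open>r\<close> in the same
      way.\<close>
    define r' where "r' = max r r0"
    have r': "0 \<le> r'" "r' < 1" "r \<le> r'" "r0 \<le> r'" using r r0 by (auto simp: r'_def)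
    let ?d = "\<lambda>z. f z - f (of_real \<rho> * z)" and ?g = "\<lambda>z. f z * f (of_real \<rho> * z)" and ?h = "\<lambda>z. (f z + f (of_real \<rho> * z)) / 2"
    have hols: "?d holomorphic_on unit_disc" "?g holomorphic_on unit_disc" "?h holomorphic_on unit_disc"
      using hol hg by (auto intro!: holomorphic_intros)
    have m1: "N - 2 * \<delta> \<le> circle_mean (p/2) ?g r'"
      using \<rho>1(2)[of \<rho>] \<rho> circle_mean_mono_radius[OF hols(2), of "p/2" r0 r'] r0 r' p by simp
    have m2: "N - 2 * \<delta> \<le> circle_mean p ?h r'"
      using \<rho>2(2)[of \<rho>] \<rho> circle_mean_mono_radius[OF hols(3), of p r0 r'] r0 r' p by simp
    have m3: "circle_mean p (\<lambda>z. f (of_real \<rho> * z)) r' \<le> N"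
    proof -
      have "\<rho> * r' \<le> r'" using \<rho> r' by (intro mult_left_le_one_le) auto
      then show ?thesis unfolding circle_mean_dilate using MN[of "\<rho> * r'"] \<rho> r' by (simp add: M_def)
    qed
    have m4: "circle_mean p f r' \<le> N" using MN[of r'] r' by (simp add: M_def)
    note hi = circle_mean_has_integral[OF holomorphic_on_imp_continuous_on _ r'(1,2)]
    let ?i = "\<lambda>g q. 2 * pi * circle_mean q g r'"
    let ?f' = "\<lambda>z. f (of_real \<rho> * z)"
    have "?i ?d p \<le> \<eta> * (?i f p + ?i ?f' p) + C * ((?i f p + ?i ?f' p - 2 * ?i ?g (p/2)) + (?i f p + ?i ?f' p - 2 * ?i ?h p))"
    proof (rule has_integral_le)
      show "((\<lambda>t. norm (?d (of_real r' * cis t)) powr p) has_integral ?i ?d p) {0..2*pi}"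
        using hols p by (intro hi) auto
      show "((\<lambda>t. \<eta> * (norm (f (of_real r' * cis t)) powr p + norm (?f' (of_real r' * cis t)) powr p) +
          C * ((norm (f (of_real r' * cis t)) powr p + norm (?f' (of_real r' * cis t)) powr p - 2 * norm (?g (of_real r' * cis t)) powr (p/2)) +
           (norm (f (of_real r' * cis t)) powr p + norm (?f' (of_real r' * cis t)) powr p - 2 * norm (?h (of_real r' * cis t)) powr p)))
        has_integral \<eta> * (?i f p + ?i ?f' p) + C * ((?i f p + ?i ?f' p - 2 * ?i ?g (p/2)) + (?i f p + ?i ?f' p - 2 * ?i ?h p))) {0..2*pi}"
        using hols hg hol p
        by (intro has_integral_add has_integral_diff has_integral_mult_right hi) auto
    qed (rule C(2))
    also have "\<dots> = 2 * pi * (\<eta> * (circle_mean p f r' + circle_mean p ?f' r') + C * ((circle_mean p f r' + circle_mean p ?f' r' - 2 * circle_mean (p/2) ?g r') + (circle_mean p f r' + circle_mean p ?f' r' - 2 * circle_mean p ?h r')))"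
      by (simp add: algebra_simps)
    finally have "circle_mean p ?d r' \<le> \<eta> * (circle_mean p f r' + circle_mean p ?f' r') + C * ((circle_mean p f r' + circle_mean p ?f' r' - 2 * circle_mean (p/2) ?g r') + (circle_mean p f r' + circle_mean p ?f' r' - 2 * circle_mean p ?h r'))"
      by simp
    also have "\<dots> \<le> \<eta> * (N + N) + C * ((N + N - 2 * (N - 2 * \<delta>)) + (N + N - 2 * (N - 2 * \<delta>)))"
      using m1 m2 m3 m4 \<eta>(1) C(1) by (intro add_mono diff_mono mult_left_mono) auto
    also have "\<dots> = 2 * \<eta> * N + e / 2" using C(1) by (simp add: \<delta>_def field_simps)
    also have "\<dots> \<le> e" using \<eta>(2) by simp
    finally have "circle_mean p ?d r' \<le> e" .
    moreover have "circle_mean p ?d r \<le> circle_mean p ?d r'"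
      using hols r r' p by (intro circle_mean_mono_radius) auto
    ultimately show "circle_mean p ?d r \<le> e" by simp
  qed (use \<rho>1 \<rho>2 in auto)
qed

section \<open>Cyclic functions\<close>

lemma circle_mean_le_mult:
  assumes "continuous_on unit_disc f" "continuous_on unit_disc g" "0 < p" "0 \<le> r" "r < 1"
    and le: "\<And>z. norm z = r \<Longrightarrow> norm (f z) powr p \<le> a * norm (g z) powr p"
  shows "circle_mean p f r \<le> a * circle_mean p g r"
  using circle_mean_le_lincomb[OF assms(1,2,2,3,4,5), of a 0] le by simp

lemma circle_mean_cong:
  assumes "\<And>z. z \<in> unit_disc \<Longrightarrow> f z = g z" "0 \<le> r" "r < 1"
  shows "circle_mean p f r = circle_mean p g r"
  unfolding circle_mean_def using assms(1)[of "of_real r * cis _"] assms(2,3) by (simp add: norm_mult)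

lemma hardy_cong:
  assumes "\<And>z. z \<in> unit_disc \<Longrightarrow> f z = g z"
  shows "f \<in> hardy p \<longleftrightarrow> g \<in> hardy p"
proof -
  have "f holomorphic_on unit_disc \<longleftrightarrow> g holomorphic_on unit_disc"
    by (rule holomorphic_cong) (use assms in auto)
  moreover have "circle_mean p f ` {0..<1} = circle_mean p g ` {0..<1}"
    by (rule image_cong) (auto intro!: circle_mean_cong assms)
  ultimately show ?thesis by (simp add: hardy_def)
qed

lemma hardy_norm_cong:
  assumes "\<And>z. z \<in> unit_disc \<Longrightarrow> f z = g z"
  shows "hardy_norm p f = hardy_norm p g"
proof -
  have "circle_mean p f ` {0..<1} = circle_mean p g ` {0..<1}"
    by (rule image_cong) (auto intro!: circle_mean_cong assms)
  then show ?thesis by (simp add: hardy_norm_def)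
qed

lemma circle_mean_le_hardy_norm:
  assumes "f \<in> hardy p" "0 < p" "0 \<le> r" "r < 1"
  shows "circle_mean p f r \<le> hardy_norm p f powr p"
proof -
  have "circle_mean p f r \<le> (SUP r\<in>{0..<1}. circle_mean p f r)"
    using assms by (intro cSUP_upper) (auto simp: hardy_def)
  also have "\<dots> = hardy_norm p f powr p"
    using assms order_trans[OF circle_mean_nonneg calculation] by (simp add: hardy_norm_def powr_powr)
  finally show ?thesis .
qed

lemma hardy_norm_le:
  assumes "\<And>r. 0 \<le> r \<Longrightarrow> r < 1 \<Longrightarrow> circle_mean p f r \<le> B powr p" "0 < p" "0 \<le> B"
  shows "hardy_norm p f \<le> B"
proof -
  have "(SUP r\<in>{0..<1}. circle_mean p f r) \<le> B powr p"
    using assms(1) by (intro cSUP_least) auto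
  moreover have "0 \<le> (SUP r\<in>{0..<1}. circle_mean p f r)"
    using circle_mean_nonneg[of p f 0] assms(1)
    by (intro cSUP_upper2[of _ _ 0]) (auto intro!: bdd_aboveI2)
  ultimately have "hardy_norm p f \<le> (B powr p) powr (1 / p)"
    unfolding hardy_norm_def using assms(2) by (intro powr_mono2) auto
  then show ?thesis using assms(2,3) by (simp add: powr_powr)
qed

lemma hardy_norm_le_bound:
  assumes "f holomorphic_on unit_disc" "\<And>z. z \<in> unit_disc \<Longrightarrow> norm (f z) \<le> B" "0 < p" "0 \<le> B"
  shows "hardy_norm p f \<le> B"
proof (rule hardy_norm_le[OF _ assms(3,4)])
  fix r :: real assume r: "0 \<le> r" "r < 1"
  have "circle_mean p f r \<le> B powr p * circle_mean p (\<lambda>z. 1) r"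
    by (intro circle_mean_le_mult) (use assms r in \<open>auto intro!: holomorphic_on_imp_continuous_on powr_mono2\<close>)
  then show "circle_mean p f r \<le> B powr p" by (simp add: circle_mean_const)
qed

section \<open>The backward shift and the coefficients at 0\<close>

text \<open>The backward shift. Its value at 0 is that of the holomorphic extension, so the
  factorisation of f(z) - f(0) holds at every point without exception.\<close>

definition div_z :: "(complex \<Rightarrow> complex) \<Rightarrow> complex \<Rightarrow> complex" where
  "div_z f z = (if z = 0 then deriv f 0 else (f z - f 0) / z)"

lemma div_z_eq: "f z = f 0 + z * div_z f z"
  by (simp add: div_z_def)

lemma div_z_holomorphic:
  assumes "f holomorphic_on unit_disc"
  shows "div_z f holomorphic_on unit_disc"
  using pole_lemma_open[OF assms open_ball, of 0, unfolded diff_zero] by (simp add: div_z_def[abs_def])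

text \<open>Division by z is expensive on small circles, so monotonicity first moves the estimate to
  a radius of at least 1/2, where it costs a factor 2. In the constant, one \<open>2 powr p\<close>
  comes from this division, another from splitting f(z) - f(0), and the remaining 2 from the two
  summands, each of mean at most \<open>B\<close>.\<close>

lemma circle_mean_div_z_le:
  assumes f: "f holomorphic_on unit_disc" and p: "0 < p" and r: "0 \<le> r" "r < 1"
    and B: "\<And>r. 0 \<le> r \<Longrightarrow> r < 1 \<Longrightarrow> circle_mean p f r \<le> B"
  shows "circle_mean p (div_z f) r \<le> 2 * 4 powr p * B"
proof -
  define r' where "r' = max r (1/2)"
  have r': "0 \<le> r'" "r' < 1" "r \<le> r'" "1/2 \<le> r'" using r by (auto simp: r'_def)
  have f0: "norm (f 0) powr p \<le> B" using B[of 0] by (simp add: circle_mean_def)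
  have "circle_mean p (div_z f) r \<le> circle_mean p (div_z f) r'"
    using r r' by (intro circle_mean_mono_radius div_z_holomorphic f p) auto
  also have "\<dots> \<le> 2 powr p * circle_mean p (\<lambda>z. f z + (- f 0)) r'"
  proof (rule circle_mean_le_mult)
    fix z :: complex assume z: "norm z = r'"
    then have "norm (div_z f z) \<le> 2 * norm (f z + (- f 0))"
      using r' mult_right_mono[of 1 "2 * norm z" "norm (f z - f 0)"]
      by (auto simp: div_z_def norm_divide divide_le_eq algebra_simps)
    then have "norm (div_z f z) powr p \<le> (2 * norm (f z + (- f 0))) powr p" using p by (intro powr_mono2) auto
    then show "norm (div_z f z) powr p \<le> 2 powr p * norm (f z + (- f 0)) powr p" by (simp add: powr_mult)
  qed (use f p r' in \<open>auto intro!: holomorphic_on_imp_continuous_on div_z_holomorphic holomorphic_intros\<close>)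
  also have "circle_mean p (\<lambda>z. f z + (- f 0)) r' \<le> 2 powr p * circle_mean p f r' + 2 powr p * circle_mean p (\<lambda>_. - f 0) r'"
    by (rule circle_mean_le_lincomb)
       (use f p r' in \<open>auto intro!: holomorphic_on_imp_continuous_on holomorphic_intros norm_add_powr_le simp del: add_uminus_conv_diff norm_minus_cancel\<close>)
  also have "\<dots> \<le> 2 powr p * B + 2 powr p * B"
    using f0 B[of r'] r' by (intro add_mono mult_left_mono) (auto simp: circle_mean_const)
  also have "2 powr p * (2 powr p * B + 2 powr p * B) = 2 * (2 * 2) powr p * B"
    unfolding powr_mult by simp
  finally show ?thesis by (simp add: mult_left_mono)
qed

lemma div_z_hardy:
  assumes "f \<in> hardy p" "0 < p"
  shows "div_z f \<in> hardy p"
proof -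
  obtain B where "\<And>r. 0 \<le> r \<Longrightarrow> r < 1 \<Longrightarrow> circle_mean p f r \<le> B" using hardy_bound[OF assms(1)] by blast
  from circle_mean_div_z_le[OF hardy_holomorphic[OF assms(1)] assms(2) _ _ this] show ?thesis
    by (intro hardyI[where B = "2 * 4 powr p * B"] div_z_holomorphic hardy_holomorphic[OF assms(1)])
qed

text \<open>The circle of radius 0 turns point values at 0 into means: of \<open>f\<close> for the
  first bound, and of \<open>div_z f\<close> for the second. The constant 8 is 2 * 4, where 1 \<le>
  p allows 2 to be replaced by \<open>2 powr p\<close>.\<close>

lemma hardy_coeff_bounds:
  assumes "f \<in> hardy p" "1 \<le> p"
  shows "norm (f 0) \<le> hardy_norm p f" "norm (deriv f 0) \<le> 8 * hardy_norm p f"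
proof -
  have p: "0 < p" using assms by simp
  have nn: "0 \<le> hardy_norm p f" by (simp add: hardy_norm_def)
  note B = circle_mean_le_hardy_norm[OF assms(1) p]
  have "norm (f 0) powr p \<le> hardy_norm p f powr p" using B[of 0] by (simp add: circle_mean_def)
  then show "norm (f 0) \<le> hardy_norm p f" using p nn by (meson norm_ge_zero powr_less_mono2 not_le)
  have "norm (deriv f 0) powr p = circle_mean p (div_z f) 0" by (simp add: circle_mean_def div_z_def)
  also have "\<dots> \<le> 2 * 4 powr p * hardy_norm p f powr p"
    using circle_mean_div_z_le[OF hardy_holomorphic[OF assms(1)] p _ _ B, of 0] by simp
  also have "\<dots> \<le> 2 powr p * 4 powr p * hardy_norm p f powr p"
    using powr_mono[of 1 p 2] assms(2) by (intro mult_right_mono) auto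
  also have "\<dots> = (8 * hardy_norm p f) powr p"
    by (simp flip: powr_mult)
  finally show "norm (deriv f 0) \<le> 8 * hardy_norm p f"
    using p nn by (meson norm_ge_zero powr_less_mono2 not_le mult_nonneg_nonneg zero_le_numeral)
qed

text \<open>Trades the span for one linear relation between the first two Taylor coefficients.
  Conversely, since \<alpha> is non-zero, \<open>c\<close> is recovered as f(0)/\<alpha>, and
  \<open>g\<close> is the backward shift applied twice.\<close>

lemma hardy_ab_iff:
  assumes p: "0 < p" and a: "\<alpha> \<noteq> 0"
  shows "f \<in> hardy_ab p \<alpha> \<beta> \<longleftrightarrow> f \<in> hardy p \<and> \<alpha> * deriv f 0 = \<beta> * f 0"
proof
  assume "f \<in> hardy_ab p \<alpha> \<beta>"
  then obtain c g where g: "g \<in> hardy p" and f: "\<And>z. z \<in> unit_disc \<Longrightarrow> f z = c * (\<alpha> + \<beta> * z) + z\<^sup>2 * g z"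
    unfolding hardy_ab_def by blast
  have "(\<lambda>z. c * (\<alpha> + \<beta> * z)) \<in> hardy p"
  proof (rule hardy_bounded[OF _ _ p])
    show "norm (c * (\<alpha> + \<beta> * z)) \<le> norm c * (norm \<alpha> + norm \<beta>)" if "z \<in> unit_disc" for z
      using that norm_triangle_ineq[of \<alpha> "\<beta> * z"] mult_left_le[of "norm z" "norm \<beta>"]
      by (auto simp: norm_mult intro!: mult_left_mono)
  qed (auto intro!: holomorphic_intros)
  moreover have "(\<lambda>z. g z * z\<^sup>2) \<in> hardy p"
    by (rule hardy_mult_bounded[OF g _ _ p, where B = 1])
       (auto intro!: holomorphic_intros simp: norm_power power_le_one)
  ultimately have "(\<lambda>z. c * (\<alpha> + \<beta> * z) + g z * z\<^sup>2) \<in> hardy p" by (rule hardy_add[OF _ _ p])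
  then have "f \<in> hardy p" using hardy_cong[of f "\<lambda>z. c * (\<alpha> + \<beta> * z) + g z * z\<^sup>2" p] f by (simp add: mult.commute)
  moreover have "deriv f 0 = c * \<beta>"
  proof (rule DERIV_imp_deriv)
    have "(g has_field_derivative deriv g 0) (at 0)"
      using holomorphic_derivI[OF hardy_holomorphic[OF g] open_ball, of 0] by simp
    then have "((\<lambda>z. c * (\<alpha> + \<beta> * z) + z\<^sup>2 * g z) has_field_derivative c * \<beta>) (at 0)"
      by (auto intro!: derivative_eq_intros)
    then show "(f has_field_derivative c * \<beta>) (at 0)"
      by (rule has_field_derivative_transform_within_open[OF _ open_ball, of _ _ _ 0 1]) (auto simp: f)
  qed
  moreover have "f 0 = c * \<alpha>" using f[of 0] by simp
  ultimately show "f \<in> hardy p \<and> \<alpha> * deriv f 0 = \<beta> * f 0" by simp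
next
  assume f: "f \<in> hardy p \<and> \<alpha> * deriv f 0 = \<beta> * f 0"
  define g where "g = div_z (div_z f)"
  have "g \<in> hardy p" using f p by (simp add: g_def div_z_hardy)
  moreover have "f z = f 0 / \<alpha> * (\<alpha> + \<beta> * z) + z\<^sup>2 * g z" for z
  proof -
    have "div_z f 0 = f 0 / \<alpha> * \<beta>" using f a by (simp add: div_z_def field_simps)
    then have "f z = f 0 + z * (f 0 / \<alpha> * \<beta> + z * g z)"
      using div_z_eq[of f z] div_z_eq[of "div_z f" z] by (simp add: g_def)
    then show ?thesis using a by (simp add: algebra_simps power2_eq_square)
  qed
  ultimately show "f \<in> hardy_ab p \<alpha> \<beta>" unfolding hardy_ab_def by blast
qed

section \<open>Functions bounded above and below are cyclic\<close>

lemma holomorphic_deriv_mult_at_0: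
  assumes "f holomorphic_on unit_disc" "g holomorphic_on unit_disc"
  shows "deriv (\<lambda>z. f z * g z) 0 = f 0 * deriv g 0 + deriv f 0 * g 0"
  using assms by (intro deriv_mult holomorphic_on_imp_differentiable_at) auto

text \<open>By the product rule a factor with vanishing derivative at 0 preserves the relation
  defining the space. The factor \<open>h\<close> ranges over H^p, so the lemma applies to bounded
  multipliers and to unbounded quotients alike.\<close>

lemma hardy_ab_mult:
  assumes p: "0 < p" and a: "\<alpha> \<noteq> 0" and f: "f holomorphic_on unit_disc" "\<And>z. z \<in> unit_disc \<Longrightarrow> norm (f z) \<le> B"
    "\<alpha> * deriv f 0 = \<beta> * f 0" and h: "h \<in> hardy p" "deriv h 0 = 0"
  shows "(\<lambda>z. f z * h z) \<in> hardy_ab p \<alpha> \<beta>"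
  unfolding hardy_ab_iff[OF p a]
  using hardy_mult_bounded[OF h(1) f(1,2) p] f(1,3) h
  by (auto simp: mult.commute[of "h _"] holomorphic_deriv_mult_at_0 hardy_holomorphic)

lemma hardy_inf1_hardy: "h \<in> hardy_inf1 \<Longrightarrow> 0 < p \<Longrightarrow> h \<in> hardy p"
  by (auto simp: hardy_inf1_def hardy_inf_def bounded_iff intro!: hardy_bounded)

text \<open>A dilation only sees the values on a compact subdisc, so unbounded functions become
  admissible multipliers.\<close>

lemma dilate_hardy_inf1:
  assumes k: "k holomorphic_on unit_disc" "deriv k 0 = 0" and \<rho>: "0 \<le> \<rho>" "\<rho> < 1"
  shows "(\<lambda>z. k (of_real \<rho> * z)) \<in> hardy_inf1"
proof -
  have sub: "of_real \<rho> * z \<in> cball 0 \<rho>" if "z \<in> unit_disc" for z :: complex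
    using that \<rho> mult_left_le[of "norm z" \<rho>] by (simp add: norm_mult)
  have sub2: "cball 0 \<rho> \<subseteq> unit_disc" using \<rho> by auto
  have "(\<lambda>z. k (of_real \<rho> * z)) holomorphic_on unit_disc"
    by (rule holomorphic_on_compose_gen[OF _ k(1), unfolded o_def])
       (use sub sub2 in \<open>auto intro!: holomorphic_intros\<close>)
  moreover have "bounded (k ` cball 0 \<rho>)"
    by (intro compact_imp_bounded compact_continuous_image holomorphic_on_imp_continuous_on
        holomorphic_on_subset[OF k(1)] sub2) auto
  then have "bounded ((\<lambda>z. k (of_real \<rho> * z)) ` unit_disc)"
    by (rule bounded_subset) (use sub in blast)
  moreover have "deriv (\<lambda>z. k (of_real \<rho> * z)) 0 = 0"
  proof (rule DERIV_imp_deriv)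
    have "(k has_field_derivative 0) (at (of_real \<rho> * 0))"
      using holomorphic_derivI[OF k(1) open_ball, of 0] k(2) by simp
    moreover have "((\<lambda>z. of_real \<rho> * z) has_field_derivative of_real \<rho>) (at 0)"
      by (auto intro!: derivative_eq_intros)
    ultimately show "((\<lambda>z. k (of_real \<rho> * z)) has_field_derivative 0) (at 0)"
      using DERIV_chain2[of k 0 "(*) (of_real \<rho>)" 0 "of_real \<rho>" UNIV] by simp
  qed
  ultimately show ?thesis by (simp add: hardy_inf1_def hardy_inf_def)
qed

text \<open>Only \<open>k\<close> is dilated while the factor \<open>f\<close> stays, so the
  approximants remain multiples of \<open>f\<close>.\<close>

lemma dilation_approx:
  assumes k: "k \<in> hardy p" and p: "1 \<le> p" and e: "0 < e"
    and f: "f holomorphic_on unit_disc" "\<And>z. z \<in> unit_disc \<Longrightarrow> norm (f z) \<le> B"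
  shows "\<exists>\<rho>0. 0 \<le> \<rho>0 \<and> \<rho>0 < 1 \<and> (\<forall>\<rho>. \<rho>0 < \<rho> \<longrightarrow> \<rho> < 1 \<longrightarrow>
           hardy_norm p (\<lambda>z. f z * k z - f z * k (of_real \<rho> * z)) < e)"
proof -
  have B0: "0 \<le> B" using f(2)[of 0] order_trans[OF norm_ge_zero] by auto
  define \<delta> where "\<delta> = e / (2 * (B + 1))"
  have \<delta>: "0 < \<delta>" "B * \<delta> \<le> e / 2" using e B0 by (auto simp: \<delta>_def field_simps)
  obtain \<rho>0 where \<rho>0: "0 \<le> \<rho>0" "\<rho>0 < 1" "\<And>\<rho> r. \<rho>0 < \<rho> \<Longrightarrow> \<rho> < 1 \<Longrightarrow> 0 \<le> r \<Longrightarrow> r < 1 \<Longrightarrow>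
           circle_mean p (\<lambda>z. k z - k (of_real \<rho> * z)) r \<le> \<delta> powr p"
    using hardy_dilation_tendsto[OF k p, of "\<delta> powr p"] \<delta> by auto
  have "hardy_norm p (\<lambda>z. f z * k z - f z * k (of_real \<rho> * z)) < e" if \<rho>: "\<rho>0 < \<rho>" "\<rho> < 1" for \<rho>
  proof -
    have "hardy_norm p (\<lambda>z. f z * k z - f z * k (of_real \<rho> * z)) \<le> B * \<delta>"
    proof (rule hardy_norm_le)
      fix r :: real assume r: "0 \<le> r" "r < 1"
      have hk: "k holomorphic_on unit_disc" using k by (rule hardy_holomorphic)
      have hk': "(\<lambda>z. k (of_real \<rho> * z)) holomorphic_on unit_disc"
        using hk \<rho> \<rho>0 by (intro dilate_holomorphic) auto
      have "circle_mean p (\<lambda>z. f z * k z - f z * k (of_real \<rho> * z)) r \<le> B powr p * circle_mean p (\<lambda>z. k z - k (of_real \<rho> * z)) r"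
      proof (rule circle_mean_le_mult)
        fix z :: complex assume z: "norm z = r"
        have "norm (f z) powr p \<le> B powr p" using f(2)[of z] z r p by (intro powr_mono2) auto
        then show "norm (f z * k z - f z * k (of_real \<rho> * z)) powr p \<le> B powr p * norm (k z - k (of_real \<rho> * z)) powr p"
          by (simp add: norm_mult powr_mult mult_right_mono flip: right_diff_distrib)
      qed (use f hk hk' p r in \<open>auto intro!: holomorphic_on_imp_continuous_on holomorphic_intros\<close>)
      also have "\<dots> \<le> B powr p * \<delta> powr p" using \<rho>0(3)[OF \<rho> r] by (intro mult_left_mono) auto
      also have "\<dots> = (B * \<delta>) powr p" by (simp add: powr_mult)
      finally show "circle_mean p (\<lambda>z. f z * k z - f z * k (of_real \<rho> * z)) r \<le> (B * \<delta>) powr p" .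
    qed (use p B0 \<delta> in auto)
    then show ?thesis using \<delta> e by simp
  qed
  then show ?thesis using \<rho>0(1,2) by blast
qed

text \<open>The defect \<open>\<tau>\<close> of the defining relation is a linear functional of
  \<open>g\<close> bounded by \<open>K\<close> times the norm, by the coefficient bounds; being 0 on
  \<open>S\<close>, it is 0 on the closure.\<close>

lemma hardy_ab_closed:
  assumes p: "1 \<le> p" and a: "\<alpha> \<noteq> 0" and S: "S \<subseteq> hardy_ab p \<alpha> \<beta>"
  shows "hardy_closure p S \<subseteq> hardy_ab p \<alpha> \<beta>"
proof
  fix g assume "g \<in> hardy_closure p S"
  then have g: "g \<in> hardy p" and cl: "\<And>\<epsilon>. 0 < \<epsilon> \<Longrightarrow> \<exists>s\<in>S. hardy_norm p (\<lambda>z. g z - s z) < \<epsilon>"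
    by (auto simp: hardy_closure_def)
  have p0: "0 < p" using p by simp
  define \<tau> where "\<tau> = \<alpha> * deriv g 0 - \<beta> * g 0"
  define K where "K = 8 * norm \<alpha> + norm \<beta>"
  have K: "0 < K" using a by (simp add: K_def add_pos_nonneg)
  have "norm \<tau> \<le> 0"
  proof (rule field_le_epsilon)
    fix e :: real assume e: "0 < e"
    obtain s where s: "s \<in> S" "hardy_norm p (\<lambda>z. g z - s z) < e / K" using cl[of "e / K"] e K by auto
    from s(1) S have s': "s \<in> hardy p" "\<alpha> * deriv s 0 = \<beta> * s 0" by (auto simp: hardy_ab_iff[OF p0 a])
    have d: "(\<lambda>z. g z - s z) \<in> hardy p" by (rule hardy_diff[OF g s'(1) p0])
    have dd: "deriv (\<lambda>z. g z - s z) 0 = deriv g 0 - deriv s 0"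
      using g s'(1) by (intro deriv_diff holomorphic_on_imp_differentiable_at[of _ unit_disc] hardy_holomorphic) auto
    have "\<tau> = \<alpha> * deriv (\<lambda>z. g z - s z) 0 - \<beta> * (g 0 - s 0)"
      unfolding dd \<tau>_def right_diff_distrib s'(2) by simp
    also have "norm \<dots> \<le> norm \<alpha> * norm (deriv (\<lambda>z. g z - s z) 0) + norm \<beta> * norm (g 0 - s 0)"
      using norm_triangle_ineq4 by (simp flip: norm_mult)
    also have "\<dots> \<le> norm \<alpha> * (8 * hardy_norm p (\<lambda>z. g z - s z)) + norm \<beta> * hardy_norm p (\<lambda>z. g z - s z)"
      using hardy_coeff_bounds[OF d p] by (intro add_mono mult_left_mono) auto
    also have "\<dots> = K * hardy_norm p (\<lambda>z. g z - s z)" by (simp add: K_def algebra_simps)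
    also have "\<dots> \<le> 0 + e" using s(2) K by (simp add: field_simps)
    finally show "norm \<tau> \<le> 0 + e" .
  qed
  then show "g \<in> hardy_ab p \<alpha> \<beta>" using g by (simp add: hardy_ab_iff[OF p0 a] \<tau>_def)
qed

text \<open>For \<open>g\<close> in the space the quotient k = g/f lies in H^p by the lower bound on
  \<open>f\<close>, and k'(0) = 0 because \<open>f\<close> and \<open>g\<close> satisfy the same
  relation. Its dilations are multipliers, and their products with \<open>f\<close> approach
  \<open>g\<close>.\<close>

lemma cyclicI:
  assumes p: "1 \<le> p" and a: "\<alpha> \<noteq> 0" and f: "f holomorphic_on unit_disc"
    "\<And>z. z \<in> unit_disc \<Longrightarrow> norm (f z) \<le> B" and b: "0 < b" "\<And>z. z \<in> unit_disc \<Longrightarrow> b \<le> norm (f z)"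
    and eq: "\<alpha> * deriv f 0 = \<beta> * f 0"
  shows "cyclic p \<alpha> \<beta> f"
proof -
  have p0: "0 < p" using p by simp
  have nz: "f z \<noteq> 0" if "z \<in> unit_disc" for z using b(1) b(2)[OF that] by auto
  have fab: "f \<in> hardy_ab p \<alpha> \<beta>"
    unfolding hardy_ab_iff[OF p0 a] using hardy_bounded[OF f p0] eq by simp
  have "{(\<lambda>z. f z * h z) | h. h \<in> hardy_inf1} \<subseteq> hardy_ab p \<alpha> \<beta>"
    using hardy_ab_mult[OF p0 a f eq] hardy_inf1_hardy[OF _ p0] by (auto simp: hardy_inf1_def)
  from hardy_ab_closed[OF p a this]
  have "hardy_closure p {(\<lambda>z. f z * h z) | h. h \<in> hardy_inf1} \<subseteq> hardy_ab p \<alpha> \<beta>" .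
  moreover have "g \<in> hardy_closure p {(\<lambda>z. f z * h z) | h. h \<in> hardy_inf1}" if "g \<in> hardy_ab p \<alpha> \<beta>" for g
  proof -
    have g: "g \<in> hardy p" "\<alpha> * deriv g 0 = \<beta> * g 0" using that by (auto simp: hardy_ab_iff[OF p0 a])
    define k where "k z = g z * (1 / f z)" for z
    have hinv: "(\<lambda>z. 1 / f z) holomorphic_on unit_disc" using f(1) nz by (auto intro!: holomorphic_intros)
    have "norm (1 / f z) \<le> 1 / b" if "z \<in> unit_disc" for z
      using b(1) b(2)[OF that] by (auto simp: norm_divide intro!: divide_left_mono mult_pos_pos)
    then have k: "k \<in> hardy p" unfolding k_def
      by (rule hardy_mult_bounded[OF g(1) hinv _ p0])
    have dk: "deriv k 0 = 0"
    proof -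
      have "deriv (\<lambda>z. 1 / f z) 0 = - deriv f 0 / (f 0)\<^sup>2"
        using holomorphic_derivI[OF f(1) open_ball, of 0] nz[of 0]
        by (intro DERIV_imp_deriv) (auto intro!: derivative_eq_intros simp: power2_eq_square)
      then have "deriv k 0 = g 0 * (- deriv f 0 / (f 0)\<^sup>2) + deriv g 0 * (1 / f 0)"
        unfolding k_def[abs_def] by (simp only: holomorphic_deriv_mult_at_0[OF hardy_holomorphic[OF g(1)] hinv])
      then have "deriv k 0 = (deriv g 0 * f 0 - g 0 * deriv f 0) / (f 0)\<^sup>2"
        using nz[of 0] by (simp add: field_simps power2_eq_square)
      moreover have "\<alpha> * (deriv g 0 * f 0 - g 0 * deriv f 0) = \<alpha> * deriv g 0 * f 0 - g 0 * (\<alpha> * deriv f 0)"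
        by (simp add: algebra_simps)
      then have "\<alpha> * (deriv g 0 * f 0 - g 0 * deriv f 0) = 0"
        unfolding g(2) eq by simp
      ultimately show ?thesis using a by simp
    qed
    have gk: "f z * k z = g z" if "z \<in> unit_disc" for z using nz[OF that] by (simp add: k_def)
    have "\<exists>s\<in>{(\<lambda>z. f z * h z) | h. h \<in> hardy_inf1}. hardy_norm p (\<lambda>z. g z - s z) < \<epsilon>" if e: "0 < \<epsilon>" for \<epsilon>
    proof -
      obtain \<rho>0 where \<rho>0: "0 \<le> \<rho>0" "\<rho>0 < 1" "\<And>\<rho>. \<rho>0 < \<rho> \<Longrightarrow> \<rho> < 1 \<Longrightarrow>
           hardy_norm p (\<lambda>z. f z * k z - f z * k (of_real \<rho> * z)) < \<epsilon>"
        using dilation_approx[OF k p e f] by blast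
      obtain \<rho> where \<rho>: "\<rho>0 < \<rho>" "\<rho> < 1" using \<rho>0(2) dense by blast
      have "hardy_norm p (\<lambda>z. g z - f z * k (of_real \<rho> * z)) < \<epsilon>"
        using \<rho>0(3)[OF \<rho>] hardy_norm_cong[of "\<lambda>z. g z - f z * k (of_real \<rho> * z)" "\<lambda>z. f z * k z - f z * k (of_real \<rho> * z)" p]
        by (simp add: gk)
      moreover have "(\<lambda>z. k (of_real \<rho> * z)) \<in> hardy_inf1"
        using \<rho> \<rho>0 k dk by (intro dilate_hardy_inf1 hardy_holomorphic) auto
      ultimately show ?thesis by (intro bexI[of _ "\<lambda>z. f z * k (of_real \<rho> * z)"]) auto
    qed
    then show ?thesis using g(1) by (simp add: hardy_closure_def)
  qed
  ultimately show ?thesis using fab by (auto simp: cyclic_def)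
qed

section \<open>Zero-free entire functions of exponential type\<close>

text \<open>The map u \<mapsto> u/(2M - u) sends the half-plane Re u < M into the unit disc and
  fixes 0, so the Schwarz lemma applies to its composition with \<open>h\<close>. The conclusion is
  kept free of division.\<close>

lemma borel_caratheodory:
  fixes h :: "complex \<Rightarrow> complex"
  assumes h: "h holomorphic_on ball 0 R" "h 0 = 0" and Re: "\<And>z. z \<in> ball 0 R \<Longrightarrow> Re (h z) < M"
    and z: "z \<in> ball 0 R"
  shows "norm (h z) * (R - norm z) \<le> 2 * M * norm z"
proof -
  have R: "0 < R" using z by (metis mem_ball_0 norm_ge_zero le_less_trans)
  have M: "0 < M" using Re[of 0] R h(2) by simp
  have in_ball: "of_real R * \<zeta> \<in> ball 0 R" if "norm \<zeta> < 1" for \<zeta> :: complex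
    using that R by (simp add: norm_mult)
  have lt: "norm (h y) < norm (2 * of_real M - h y)" if "y \<in> ball 0 R" for y
  proof -
    have "(Re (h y))\<^sup>2 < (2 * M - Re (h y))\<^sup>2"
      using Re[OF that] M mult_pos_pos[of M "M - Re (h y)"] by (simp add: power2_eq_square algebra_simps)
    then have "(norm (h y))\<^sup>2 < (norm (2 * of_real M - h y))\<^sup>2"
      unfolding cmod_power2 by simp
    then show ?thesis by (rule power2_less_imp_less) simp
  qed
  then have nz: "2 * of_real M - h y \<noteq> 0" if "y \<in> ball 0 R" for y
    using that by (metis norm_ge_zero norm_zero not_le)
  define F where "F \<zeta> = h (of_real R * \<zeta>) / (2 * of_real M - h (of_real R * \<zeta>))" for \<zeta>
  have hR: "(\<lambda>\<zeta>. h (of_real R * \<zeta>)) holomorphic_on ball 0 1"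
    by (rule holomorphic_on_compose_gen[OF _ h(1), unfolded o_def])
       (use in_ball in \<open>auto intro!: holomorphic_intros\<close>)
  have "F holomorphic_on ball 0 1"
    unfolding F_def by (intro holomorphic_intros hR) (use nz in_ball in auto)
  moreover have "F 0 = 0" by (simp add: F_def h(2))
  moreover have "norm (F \<zeta>) < 1" if "norm \<zeta> < 1" for \<zeta>
    using lt[OF in_ball[OF that]] nz[OF in_ball[OF that]] by (simp add: F_def norm_divide divide_less_eq)
  moreover have "norm (z / of_real R) < 1" using z R by (simp add: norm_divide)
  ultimately have "norm (F (z / of_real R)) \<le> norm (z / of_real R)" by (rule Schwarz_Lemma(1))
  then have "norm (h z) * R \<le> norm z * norm (2 * of_real M - h z)"
    using R nz[OF z] by (simp add: F_def norm_divide field_simps)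
  also have "\<dots> \<le> norm z * (2 * M + norm (h z))"
    using norm_triangle_ineq4[of "2 * of_real M" "h z"] M by (intro mult_left_mono) (auto simp: norm_mult)
  finally show ?thesis by (simp add: algebra_simps)
qed

text \<open>The real part of a logarithm grows at most linearly; the preceding inequality transfers
  this to its modulus, and Liouville's theorem makes the logarithm affine.\<close>

lemma zero_free_exponential_type:
  assumes hol: "\<Phi> holomorphic_on UNIV" and nz: "\<And>z. \<Phi> z \<noteq> 0" and A: "0 < A" and B: "0 \<le> B"
    and bd: "\<And>z. norm (\<Phi> z) \<le> A * exp (B * norm z)"
  shows "\<exists>b. \<forall>z. \<Phi> z = \<Phi> 0 * exp (b * z)"
proof -
  obtain g where g: "g holomorphic_on UNIV" "\<And>z. \<Phi> z = exp (g z)"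
    using contractible_imp_holomorphic_log[OF hol convex_imp_contractible[OF convex_UNIV] nz] by (metis UNIV_I)
  define h where "h z = g z - g 0" for z
  have h: "h holomorphic_on UNIV" "h 0 = 0" unfolding h_def by (auto intro!: holomorphic_intros g)
  \<comment> \<open>The added 1 makes \<open>M\<close> positive and the bound on the real part
    strict, as required for the half-plane argument.\<close>
  define M where "M = \<bar>ln A - Re (g 0)\<bar> + 1"
  have M: "0 < M" by (simp add: M_def)
  have Re: "Re (h z) < M + B * norm z" for z
  proof -
    have "exp (Re (g z)) \<le> exp (ln A + B * norm z)"
      using bd[of z] A by (simp add: g(2) exp_add)
    then show ?thesis by (simp add: h_def M_def)
  qed
  \<comment> \<open>With the ball of radius 2|z| the factor R - |z| equals |z| and cancels. The
    condition |z| \<ge> 1 absorbs the constant term into the linear one.\<close>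
  have growth: "norm (h z) \<le> 2 * (M + 2 * B) * norm z ^ 1" if z: "1 \<le> norm z" for z
  proof -
    have "norm (h z) * (2 * norm z - norm z) \<le> 2 * (M + B * (2 * norm z)) * norm z"
    proof (rule borel_caratheodory[OF holomorphic_on_subset[OF h(1)] h(2)])
      fix y :: complex assume y: "y \<in> ball 0 (2 * norm z)"
      then have "B * norm y \<le> B * (2 * norm z)" using B by (intro mult_left_mono) auto
      then show "Re (h y) < M + B * (2 * norm z)" using Re[of y] by simp
    qed (use z in auto)
    then have "norm (h z) * norm z \<le> 2 * (M + B * (2 * norm z)) * norm z" by simp
    then have "norm (h z) \<le> 2 * (M + B * (2 * norm z))"
      by (rule mult_right_le_imp_le) (use z in linarith)
    also have "\<dots> \<le> 2 * (M * norm z + B * (2 * norm z))" using M z by simp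
    finally show ?thesis by (simp add: algebra_simps)
  qed
  have "h z = deriv h 0 * z" for z
    using Liouville_polynomial[OF h(1) growth, where \<xi> = z] h(2) by simp
  then have "\<Phi> z = \<Phi> 0 * exp (deriv h 0 * z)" for z
    by (metis g(2) h_def exp_add add.commute diff_add_cancel)
  then show ?thesis by blast
qed

text \<open>The factor 1/n! matches the exponential series, so comparing coefficients leaves a
  geometric sequence. It is used with \<open>c n\<close> the value of the functional on the n-th
  power of a multiplier.\<close>

lemma zero_free_power_series_coeffs:
  fixes c :: "nat \<Rightarrow> complex"
  assumes sums: "\<And>z. (\<lambda>n. c n / fact n * z ^ n) sums \<Phi> z" and nz: "\<And>z. \<Phi> z \<noteq> 0" and A: "0 < A" and B: "0 \<le> B"
    and bd: "\<And>z. norm (\<Phi> z) \<le> A * exp (B * norm z)"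
  shows "\<exists>b. \<forall>n. c n = c 0 * b ^ n"
proof -
  define F where "F = Abs_fps (\<lambda>n. c n / fact n)"
  have rad: "fps_conv_radius F = \<infinity>"
    unfolding fps_conv_radius_def
    by (rule conv_radius_inftyI'') (use sums in \<open>auto simp: F_def sums_iff\<close>)
  have eval: "eval_fps F z = \<Phi> z" for z
    using sums[of z] by (simp add: eval_fps_def F_def sums_iff)
  have "eval_fps F holomorphic_on UNIV"
    by (rule holomorphic_on_eval_fps) (simp add: rad eball_def)
  moreover have "eval_fps F = \<Phi>" using eval by blast
  ultimately have hol: "\<Phi> holomorphic_on UNIV" by simp
  obtain b where b: "\<And>z. \<Phi> z = \<Phi> 0 * exp (b * z)"
    using zero_free_exponential_type[OF hol nz A B bd] by blast
  have c0: "\<Phi> 0 = c 0" using sums_unique2[OF sums[of 0] powser_sums_zero[of "\<lambda>n. c n / fact n"]] by simp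
  define G where "G = fps_const (c 0) * fps_exp b"
  have "F = G"
  proof (rule eval_fps_eqD)
    show "fps_conv_radius F > 0" using rad by simp
    have "fps_conv_radius G \<ge> min (fps_conv_radius (fps_const (c 0))) (fps_conv_radius (fps_exp b))"
      unfolding G_def by (rule fps_conv_radius_mult)
    then have radG: "fps_conv_radius G = \<infinity>" by simp
    then show "fps_conv_radius G > 0" by simp
    have "eval_fps F z = eval_fps G z" for z
      unfolding G_def by (subst eval_fps_mult) (simp_all add: eval b[of z] c0)
    then show "eventually (\<lambda>z. eval_fps F z = eval_fps G z) (nhds 0)" by simp
  qed
  have coeff: "c n / fact n = c 0 * (b ^ n / fact n)" for n
  proof -
    have "fps_nth F n = c n / fact n" unfolding F_def fps_nth_Abs_fps ..
    moreover have "fps_nth G n = c 0 * (b ^ n / fact n)"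
      unfolding G_def fps_mult_left_const_nth fps_exp_def fps_nth_Abs_fps of_nat_fact ..
    ultimately show ?thesis unfolding \<open>F = G\<close> by (rule trans[OF sym])
  qed
  have "c n = c 0 * b ^ n" for n
    using coeff[of n] by (simp add: divide_eq_eq)
  then show ?thesis by blast
qed

section \<open>Functionals on the multiplier algebra\<close>

lemma hardy_inf1I:
  assumes "f holomorphic_on unit_disc" "\<And>z. z \<in> unit_disc \<Longrightarrow> norm (f z) \<le> B" "deriv f 0 = 0"
  shows "f \<in> hardy_inf1"
proof -
  have "bounded (f ` unit_disc)" unfolding bounded_iff using assms(2) by blast
  then show ?thesis using assms by (simp add: hardy_inf1_def hardy_inf_def)
qed

lemma hardy_inf1_bound:
  assumes "f \<in> hardy_inf1"
  obtains B where "0 \<le> B" "\<And>z. z \<in> unit_disc \<Longrightarrow> norm (f z) \<le> B"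
proof -
  have "bounded (f ` unit_disc)" using assms by (simp add: hardy_inf1_def hardy_inf_def)
  then obtain B where B: "\<And>z. z \<in> unit_disc \<Longrightarrow> norm (f z) \<le> B"
    unfolding bounded_iff by blast
  then have "0 \<le> B" using order_trans[OF norm_ge_zero B[of 0]] by simp
  then show ?thesis using that B by blast
qed

lemma hardy_inf1_holomorphic: "f \<in> hardy_inf1 \<Longrightarrow> f holomorphic_on unit_disc"
  by (simp add: hardy_inf1_def hardy_inf_def)

lemma hardy_inf1_deriv: "f \<in> hardy_inf1 \<Longrightarrow> deriv f 0 = 0"
  by (simp add: hardy_inf1_def)

lemma hardy_inf1_const: "(\<lambda>z. c) \<in> hardy_inf1"
  by (rule hardy_inf1I[where B = "norm c"]) auto

lemma hardy_inf1_mult: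
  assumes f: "f \<in> hardy_inf1" and g: "g \<in> hardy_inf1"
  shows "(\<lambda>z. f z * g z) \<in> hardy_inf1"
proof -
  obtain B where B: "0 \<le> B" "\<And>z. z \<in> unit_disc \<Longrightarrow> norm (f z) \<le> B" using hardy_inf1_bound[OF f] by blast
  obtain C where C: "0 \<le> C" "\<And>z. z \<in> unit_disc \<Longrightarrow> norm (g z) \<le> C" using hardy_inf1_bound[OF g] by blast
  note hol = f[THEN hardy_inf1_holomorphic] g[THEN hardy_inf1_holomorphic]
  show ?thesis
  proof (rule hardy_inf1I)
    show "norm (f z * g z) \<le> B * C" if "z \<in> unit_disc" for z
      unfolding norm_mult using B C that by (intro mult_mono) auto
    show "deriv (\<lambda>z. f z * g z) 0 = 0"
      unfolding holomorphic_deriv_mult_at_0[OF hol] using f g by (simp add: hardy_inf1_deriv)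
  qed (intro holomorphic_intros hol)
qed

lemma hardy_inf1_add:
  assumes f: "f \<in> hardy_inf1" and g: "g \<in> hardy_inf1"
  shows "(\<lambda>z. f z + g z) \<in> hardy_inf1"
proof -
  obtain B where B: "0 \<le> B" "\<And>z. z \<in> unit_disc \<Longrightarrow> norm (f z) \<le> B" using hardy_inf1_bound[OF f] by blast
  obtain C where C: "0 \<le> C" "\<And>z. z \<in> unit_disc \<Longrightarrow> norm (g z) \<le> C" using hardy_inf1_bound[OF g] by blast
  note hol = f[THEN hardy_inf1_holomorphic] g[THEN hardy_inf1_holomorphic]
  show ?thesis
  proof (rule hardy_inf1I)
    show "norm (f z + g z) \<le> B + C" if "z \<in> unit_disc" for z
      using B C that by (intro norm_triangle_mono) auto
    have "deriv (\<lambda>z. f z + g z) 0 = deriv f 0 + deriv g 0"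
      using hol by (intro deriv_add holomorphic_on_imp_differentiable_at[of _ unit_disc]) auto
    then show "deriv (\<lambda>z. f z + g z) 0 = 0" using f g by (simp add: hardy_inf1_deriv)
  qed (intro holomorphic_intros hol)
qed

lemma hardy_inf1_cmult: "f \<in> hardy_inf1 \<Longrightarrow> (\<lambda>z. c * f z) \<in> hardy_inf1"
  by (rule hardy_inf1_mult[OF hardy_inf1_const])

lemma hardy_inf1_power: "f \<in> hardy_inf1 \<Longrightarrow> (\<lambda>z. f z ^ n) \<in> hardy_inf1"
  by (induction n) (auto intro: hardy_inf1_const hardy_inf1_mult)

lemma hardy_inf1_sum:
  "finite A \<Longrightarrow> (\<And>i. i \<in> A \<Longrightarrow> f i \<in> hardy_inf1) \<Longrightarrow> (\<lambda>z. \<Sum>i\<in>A. f i z) \<in> hardy_inf1"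
  by (induction A rule: finite_induct) (auto intro: hardy_inf1_const hardy_inf1_add)

lemma monomial_hardy_inf1:
  assumes "n \<noteq> 1"
  shows "(\<lambda>z. z ^ n) \<in> hardy_inf1"
proof (rule hardy_inf1I[where B = 1])
  have "((\<lambda>z :: complex. z ^ n) has_field_derivative of_nat n * 0 ^ (n - 1)) (at 0)"
    by (auto intro!: derivative_eq_intros)
  then show "deriv (\<lambda>z :: complex. z ^ n) 0 = 0"
    using assms by (cases n) (auto dest!: DERIV_imp_deriv simp: power_0_left)
qed (auto intro!: holomorphic_intros simp: norm_power power_le_one)

lemma exp_hardy_inf1:
  assumes f: "f \<in> hardy_inf1"
  shows "(\<lambda>z. exp (f z)) \<in> hardy_inf1"
proof -
  obtain B where B: "0 \<le> B" "\<And>z. z \<in> unit_disc \<Longrightarrow> norm (f z) \<le> B" using hardy_inf1_bound[OF f] by blast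
  show ?thesis
  proof (rule hardy_inf1I)
    show "norm (exp (f z)) \<le> exp B" if "z \<in> unit_disc" for z
      using order_trans[OF norm_exp] B(2)[OF that] by (metis exp_le_cancel_iff)
    have "(f has_field_derivative 0) (at 0)"
      using holomorphic_derivI[OF hardy_inf1_holomorphic[OF f] open_ball, of 0] hardy_inf1_deriv[OF f] by simp
    then have "((\<lambda>z. exp (f z)) has_field_derivative 0) (at 0)"
      by (auto intro!: derivative_eq_intros)
    then show "deriv (\<lambda>z. exp (f z)) 0 = 0" by (rule DERIV_imp_deriv)
  qed (intro holomorphic_intros hardy_inf1_holomorphic[OF f])
qed

lemma hardy_norm_cmult_le:
  assumes "f \<in> hardy p" "0 < p"
  shows "hardy_norm p (\<lambda>z. a * f z) \<le> norm a * hardy_norm p f"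
proof (rule hardy_norm_le)
  fix r :: real assume r: "0 \<le> r" "r < 1"
  have "circle_mean p (\<lambda>z. a * f z) r \<le> norm a powr p * circle_mean p f r"
    by (rule circle_mean_le_mult)
       (use assms hardy_continuous r in \<open>auto simp: norm_mult powr_mult intro!: continuous_intros\<close>)
  also have "\<dots> \<le> norm a powr p * hardy_norm p f powr p"
    using assms r by (intro mult_left_mono circle_mean_le_hardy_norm) auto
  finally show "circle_mean p (\<lambda>z. a * f z) r \<le> (norm a * hardy_norm p f) powr p"
    by (simp add: powr_mult hardy_norm_def)
qed (use assms in \<open>auto simp: hardy_norm_def\<close>)

lemma linear_functional_bound:
  assumes p: "0 < p" and X: "X \<subseteq> hardy p" "(\<lambda>z. 0) \<in> X" "\<And>a f. f \<in> X \<Longrightarrow> (\<lambda>z. a * f z) \<in> X"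
    and lin: "linear_functional_on X \<Lambda>" and cont: "hardy_continuous_on p X \<Lambda>"
  shows "\<exists>K>0. \<forall>f\<in>X. norm (\<Lambda> f) \<le> K * hardy_norm p f"
proof -
  have scale: "\<Lambda> (\<lambda>z. a * f z) = a * \<Lambda> f" if "f \<in> X" for a f
    using lin that by (simp add: linear_functional_on_def)
  have zero: "\<Lambda> (\<lambda>z. 0) = 0" using scale[OF X(2), of 0] by simp
  have "\<exists>\<delta>>0. \<forall>g\<in>X. hardy_norm p (\<lambda>z. g z - 0) < \<delta> \<longrightarrow> norm (\<Lambda> g - \<Lambda> (\<lambda>z. 0)) < 1"
    using cont[unfolded hardy_continuous_on_def, rule_format, OF X(2), of 1] by simp
  then obtain \<delta> where \<delta>: "\<delta> > 0" "\<And>g. g \<in> X \<Longrightarrow> hardy_norm p g < \<delta> \<Longrightarrow> norm (\<Lambda> g) < 1"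
    by (auto simp: zero)
  have "norm (\<Lambda> f) \<le> 2 / \<delta> * hardy_norm p f" if f: "f \<in> X" for f
  proof (rule field_le_epsilon)
    fix e :: real assume e: "0 < e"
    \<comment> \<open>The summand with \<open>e\<close> keeps \<open>t\<close> positive when the
      norm of \<open>f\<close> is 0, and becomes exactly \<open>e\<close> after multiplication by
      2/\<delta>.\<close>
    define t where "t = hardy_norm p f + e * \<delta> / 2"
    have t: "0 < t" "hardy_norm p f \<le> t"
      using e \<delta> by (auto simp: t_def hardy_norm_def intro!: add_nonneg_pos)
    define a where "a = complex_of_real (\<delta> / (2 * t))"
    have na: "norm a = \<delta> / (2 * t)" using t \<delta> by (simp add: a_def norm_divide norm_mult)
    have "hardy_norm p (\<lambda>z. a * f z) \<le> norm a * hardy_norm p f"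
      using f X(1) p by (intro hardy_norm_cmult_le) auto
    also have "\<dots> \<le> \<delta> / (2 * t) * t" unfolding na using t \<delta> by (intro mult_left_mono) auto
    also have "\<dots> < \<delta>" using t \<delta> by simp
    finally have "norm (\<Lambda> (\<lambda>z. a * f z)) < 1" using \<delta>(2) X(3) f by blast
    then have "\<delta> / (2 * t) * norm (\<Lambda> f) < 1" using f by (simp add: scale norm_mult na)
    then have "norm (\<Lambda> f) < 2 * t / \<delta>" using t \<delta> by (simp add: field_simps)
    also have "\<dots> = 2 / \<delta> * hardy_norm p f + e" using \<delta> by (simp add: t_def field_simps)
    finally show "norm (\<Lambda> f) \<le> 2 / \<delta> * hardy_norm p f + e" by simp
  qed
  then show ?thesis using \<delta> by (intro exI[of _ "2 / \<delta>"]) auto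
qed

section \<open>The Gleason-Kahane-Zelazko argument for an abstract functional\<close>

text \<open>Boundedness in the supremum norm, with an arbitrary bound \<open>B\<close> on the disc
  in place of the norm itself.\<close>

locale bounded_functional_inf1 =
  fixes L :: "(complex \<Rightarrow> complex) \<Rightarrow> complex" and K :: real
  assumes L_add: "f \<in> hardy_inf1 \<Longrightarrow> g \<in> hardy_inf1 \<Longrightarrow> L (\<lambda>z. f z + g z) = L f + L g"
    and L_cmult: "f \<in> hardy_inf1 \<Longrightarrow> L (\<lambda>z. a * f z) = a * L f"
    and K_pos: "0 < K"
    and L_bound: "f \<in> hardy_inf1 \<Longrightarrow> (\<And>z. z \<in> unit_disc \<Longrightarrow> norm (f z) \<le> B) \<Longrightarrow> norm (L f) \<le> K * B"
begin

lemma L_diff: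
  assumes "f \<in> hardy_inf1" "g \<in> hardy_inf1"
  shows "L (\<lambda>z. f z - g z) = L f - L g"
  using L_add[OF assms(1) hardy_inf1_cmult[OF assms(2), of "-1"]] L_cmult[OF assms(2), of "-1"] by simp

lemma L_sum:
  assumes "finite A" "\<And>i. i \<in> A \<Longrightarrow> f i \<in> hardy_inf1"
  shows "L (\<lambda>z. \<Sum>i\<in>A. f i z) = (\<Sum>i\<in>A. L (f i))"
  using assms
proof (induction A rule: finite_induct)
  case empty
  show ?case using L_cmult[OF hardy_inf1_const, of 0] by simp
next
  case (insert x F)
  then show ?case by (simp add: L_add hardy_inf1_sum)
qed

lemma L_uniform_limit:
  assumes "\<And>n. f n \<in> hardy_inf1" "g \<in> hardy_inf1"
    and "\<And>n z. z \<in> unit_disc \<Longrightarrow> norm (g z - f n z) \<le> e n" "e \<longlonglongrightarrow> 0"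
  shows "(\<lambda>n. L (f n)) \<longlonglongrightarrow> L g"
proof (rule LIM_zero_cancel, rule Lim_null_comparison)
  have "(\<lambda>z. g z - f n z) \<in> hardy_inf1" for n
    using hardy_inf1_add[OF assms(2) hardy_inf1_cmult[OF assms(1), of "-1"]] by simp
  then have "norm (L (\<lambda>z. g z - f n z)) \<le> K * e n" for n
    using assms(3) by (rule L_bound)
  then show "eventually (\<lambda>n. norm (L (f n) - L g) \<le> K * e n) sequentially"
    using assms by (simp add: L_diff norm_minus_commute)
  show "(\<lambda>n. K * e n) \<longlonglongrightarrow> 0" using tendsto_mult_left[OF assms(4), of K] by simp
qed

text \<open>Since \<open>a\<close> is bounded, the exponential series converges uniformly on the
  disc, at a rate given by the Taylor remainder; hence \<open>L\<close> may be applied term by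
  term.\<close>

lemma L_exp_sums:
  assumes a: "a \<in> hardy_inf1"
  shows "(\<lambda>n. L (\<lambda>z. a z ^ n) / fact n * t ^ n) sums L (\<lambda>z. exp (t * a z))"
proof -
  obtain B where B: "0 \<le> B" "\<And>z. z \<in> unit_disc \<Longrightarrow> norm (a z) \<le> B" using hardy_inf1_bound[OF a] by blast
  define R where "R = norm t * B"
  have R: "0 \<le> R" using B by (simp add: R_def)
  define f where "f n z = (\<Sum>i\<le>n. t ^ i / fact i * a z ^ i)" for n z
  have mem: "(\<lambda>z. t ^ i / fact i * a z ^ i) \<in> hardy_inf1" for i
    by (intro hardy_inf1_cmult hardy_inf1_power a)
  have Li: "L (\<lambda>z. t ^ i / fact i * a z ^ i) = L (\<lambda>z. a z ^ i) / fact i * t ^ i" for i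
    unfolding L_cmult[OF hardy_inf1_power[OF a]] by simp
  have Lf: "L (f n) = (\<Sum>i\<le>n. L (\<lambda>z. a z ^ i) / fact i * t ^ i)" for n
    unfolding f_def L_sum[OF finite_atMost mem] Li ..
  have "(\<lambda>n. L (f n)) \<longlonglongrightarrow> L (\<lambda>z. exp (t * a z))"
  proof (rule L_uniform_limit)
    show "f n \<in> hardy_inf1" for n unfolding f_def by (intro hardy_inf1_sum mem) auto
    show "(\<lambda>z. exp (t * a z)) \<in> hardy_inf1" by (intro exp_hardy_inf1 hardy_inf1_cmult a)
    show "norm (exp (t * a z) - f n z) \<le> exp R * R * (R ^ n / fact n)" if "z \<in> unit_disc" for n z
    proof -
      have le: "norm (t * a z) \<le> R" unfolding R_def norm_mult using B that by (intro mult_left_mono) auto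
      have "norm (exp (t * a z) - f n z) \<le> exp (norm (t * a z)) * norm (t * a z) ^ Suc n / fact n"
        using Taylor_exp_field[of "t * a z" n] by (simp add: f_def power_mult_distrib)
      also have "\<dots> \<le> exp R * R ^ Suc n / fact n"
        using le R by (intro divide_right_mono mult_mono power_mono) auto
      finally show ?thesis by simp
    qed
    have "(\<lambda>n. R ^ n / fact n) \<longlonglongrightarrow> 0"
      using summable_LIMSEQ_zero[OF summable_exp[of R]] by (simp add: field_simps)
    then show "(\<lambda>n. exp R * R * (R ^ n / fact n)) \<longlonglongrightarrow> 0" by (rule tendsto_mult_right_zero)
  qed
  then show ?thesis unfolding sums_def_le Lf .
qed

end

text \<open>Non-vanishing on exponentials is what the hypothesis on cyclic functions becomes after
  the factor \<open>E\<close> has been split off.\<close>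

locale zero_free_functional_inf1 = bounded_functional_inf1 +
  assumes L_exp_nonzero: "f \<in> hardy_inf1 \<Longrightarrow> L (\<lambda>z. exp (f z)) \<noteq> 0"
begin

abbreviation "L1 \<equiv> L (\<lambda>z. 1)"

lemma L1_nonzero: "L1 \<noteq> 0"
  using L_exp_nonzero[OF hardy_inf1_const[of 0]] by simp

lemma L_const: "L (\<lambda>z. c) = c * L1"
  using L_cmult[OF hardy_inf1_const[of 1], of c] by simp

lemma L_power:
  assumes a: "a \<in> hardy_inf1"
  shows "L (\<lambda>z. a z ^ n) = L1 * (L a / L1) ^ n"
proof -
  obtain B where B: "0 \<le> B" "\<And>z. z \<in> unit_disc \<Longrightarrow> norm (a z) \<le> B" using hardy_inf1_bound[OF a] by blast
  have "\<exists>b. \<forall>n. L (\<lambda>z. a z ^ n) = L (\<lambda>z. a z ^ 0) * b ^ n"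
  proof (rule zero_free_power_series_coeffs[OF L_exp_sums[OF a] _ K_pos B(1)])
    fix t :: complex
    have mem: "(\<lambda>z. t * a z) \<in> hardy_inf1" by (intro hardy_inf1_cmult a)
    show "L (\<lambda>z. exp (t * a z)) \<noteq> 0" by (rule L_exp_nonzero[OF mem])
    show "norm (L (\<lambda>z. exp (t * a z))) \<le> K * exp (B * norm t)"
    proof (rule L_bound[OF exp_hardy_inf1[OF mem]])
      fix z :: complex assume "z \<in> unit_disc"
      then have "norm (t * a z) \<le> B * norm t"
        unfolding norm_mult using B(2)[of z] by (subst mult.commute) (intro mult_right_mono, auto)
      then show "norm (exp (t * a z)) \<le> exp (B * norm t)"
        using order_trans[OF norm_exp] by (metis exp_le_cancel_iff)
    qed
  qed
  then obtain b where b: "\<And>n. L (\<lambda>z. a z ^ n) = L1 * b ^ n" by auto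
  \<comment> \<open>The exponent 1 identifies the base of the geometric sequence.\<close>
  from b[of 1] L1_nonzero have "b = L a / L1" by (simp add: field_simps)
  then show ?thesis using b by simp
qed

text \<open>Polarisation: squares are handled by \<open>L_power\<close> with exponent 2, and the
  square of a + b isolates the mixed product.\<close>

lemma L_mult:
  assumes a: "a \<in> hardy_inf1" and b: "b \<in> hardy_inf1"
  shows "L (\<lambda>z. a z * b z) * L1 = L a * L b"
proof -
  have sq: "L (\<lambda>z. f z ^ 2) * L1 = (L f)\<^sup>2" if "f \<in> hardy_inf1" for f
    using L_power[OF that, of 2] L1_nonzero by (simp add: power_divide power2_eq_square)
  have "(\<lambda>z. (a z + b z)\<^sup>2) = (\<lambda>z. ((a z)\<^sup>2 + (b z)\<^sup>2) + 2 * (a z * b z))"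
    by (simp add: fun_eq_iff power2_sum)
  then have "L (\<lambda>z. (a z + b z)\<^sup>2) = L (\<lambda>z. (a z)\<^sup>2) + L (\<lambda>z. (b z)\<^sup>2) + 2 * L (\<lambda>z. a z * b z)"
    using a b by (simp add: L_add L_cmult hardy_inf1_add hardy_inf1_power hardy_inf1_mult hardy_inf1_cmult)
  moreover have "L (\<lambda>z. (a z + b z)\<^sup>2) * L1 = (L a + L b)\<^sup>2"
    using sq[OF hardy_inf1_add[OF a b]] a b by (simp add: L_add)
  ultimately have "(L a)\<^sup>2 + (L b)\<^sup>2 + 2 * (L (\<lambda>z. a z * b z) * L1) = (L a + L b)\<^sup>2"
    using sq[OF a] sq[OF b] by (simp add: algebra_simps)
  then show ?thesis by (simp add: power2_sum)
qed

text \<open>The exponents 2 and 3 generate every exponent other than 0 and 1, so \<open>w\<close>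
  only has to satisfy two equations. They are compatible because both sides of \<open>cube\<close>
  equal the value of \<open>\<phi>\<close> at 6.\<close>

lemma L_monomial:
  "\<exists>w. \<forall>n. n \<noteq> 1 \<longrightarrow> L (\<lambda>z. z ^ n) = L1 * w ^ n"
proof -
  define \<phi> where "\<phi> n = L (\<lambda>z. z ^ n) / L1" for n
  have add: "\<phi> (m + n) = \<phi> m * \<phi> n" if "m \<noteq> 1" "n \<noteq> 1" for m n
    using L_mult[OF monomial_hardy_inf1[OF that(1)] monomial_hardy_inf1[OF that(2)]] L1_nonzero
    by (simp add: \<phi>_def power_add field_simps)
  have cube: "\<phi> 2 ^ 3 = \<phi> 3 ^ 2"
  proof -
    have "\<phi> 6 = \<phi> 3 * \<phi> 3" using add[of 3 3] by simp
    moreover have "\<phi> 6 = \<phi> 2 * \<phi> 4" using add[of 2 4] by simp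
    moreover have "\<phi> 4 = \<phi> 2 * \<phi> 2" using add[of 2 2] by simp
    ultimately show ?thesis by (simp add: power2_eq_square power3_eq_cube mult.assoc)
  qed
  \<comment> \<open>If \<open>\<phi> 2\<close> is 0 then so is \<open>\<phi> 3\<close> by
    \<open>cube\<close>, and the default 0 of the division is the right value.\<close>
  define w where "w = \<phi> 3 / \<phi> 2"
  have w: "\<phi> 2 = w ^ 2" "\<phi> 3 = w ^ 3"
  proof -
    have "\<phi> 2 = w ^ 2 \<and> \<phi> 3 = w ^ 3"
    proof (cases "\<phi> 2 = 0")
      case True then show ?thesis using cube by (simp add: w_def)
    next
      case False
      have "w ^ 2 = \<phi> 3 ^ 2 / \<phi> 2 ^ 2" by (simp add: w_def power_divide)
      also have "\<dots> = \<phi> 2" using False unfolding cube[symmetric] by (simp add: power2_eq_square power3_eq_cube)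
      finally have w2: "w ^ 2 = \<phi> 2" .
      have "w ^ 3 = w ^ 2 * w" by (simp add: power2_eq_square power3_eq_cube)
      also have "\<dots> = \<phi> 3" unfolding w2 using False by (simp add: w_def)
      finally show ?thesis using w2 by simp
    qed
    then show "\<phi> 2 = w ^ 2" "\<phi> 3 = w ^ 3" by auto
  qed
  have "\<phi> n = w ^ n" if "n \<noteq> 1" for n
    using that
  proof (induction n rule: less_induct)
    case (less n)
    consider "n = 0" | "n = 2" | "n = 3" | "n \<ge> 4" using less.prems by linarith
    then show ?case
    proof cases
      case 4
      \<comment> \<open>Here m \<ge> 2, so the missing exponent 1 is avoided; for n = 3 it would
        occur, hence the separate base case.\<close>
      then obtain m where m: "n = 2 + m" "m \<noteq> 1" "m < n" by (auto dest!: le_Suc_ex)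
      then show ?thesis using add[of 2 m] less.IH[of m] w(1) by (simp add: power_add power2_eq_square)
    qed (use w L1_nonzero in \<open>auto simp: \<phi>_def\<close>)
  qed
  then show ?thesis using L1_nonzero by (intro exI[of _ w]) (auto simp: \<phi>_def field_simps)
qed

end

section \<open>Dilations and the location of \<open>w\<close>\<close>

context zero_free_functional_inf1
begin

text \<open>The Taylor series of a dilation converges uniformly on the disc.\<close>

lemma L_dilate:
  assumes w: "\<And>n. n \<noteq> 1 \<Longrightarrow> L (\<lambda>z. z ^ n) = L1 * w ^ n" and w1: "norm w \<le> 1"
    and k: "k holomorphic_on unit_disc" "deriv k 0 = 0" and \<rho>: "0 \<le> \<rho>" "\<rho> < 1"
  shows "L (\<lambda>z. k (of_real \<rho> * z)) = L1 * k (of_real \<rho> * w)"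
proof -
  define a where "a n = (deriv ^^ n) k 0 / fact n" for n
  have a1: "a (Suc 0) = 0" using k(2) by (simp add: a_def)
  have ser: "(\<lambda>n. a n * \<zeta> ^ n) sums k \<zeta>" if "norm \<zeta> < 1" for \<zeta>
    using holomorphic_power_series[OF k(1), of \<zeta>] that by (simp add: a_def)
  \<comment> \<open>The monomial of degree 1 is outside the algebra and is replaced by 0, which is
    harmless because its coefficient vanishes.\<close>
  define f where "f n z = (\<Sum>i<n. (a i * of_real \<rho> ^ i) * (if i = 1 then 0 else z ^ i))" for n and z :: complex
  have mono: "(\<lambda>z :: complex. if i = 1 then 0 else z ^ i) \<in> hardy_inf1" for i
    using hardy_inf1_const[of 0] monomial_hardy_inf1[of i] by (cases "i = 1") auto
  have f_eq: "f n z = (\<Sum>i<n. a i * (of_real \<rho> * z) ^ i)" for n z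
    unfolding f_def by (rule sum.cong) (auto simp: a1 power_mult_distrib)
  have Lmono: "L (\<lambda>z. if i = 1 then 0 else z ^ i) = (if i = 1 then 0 else L1 * w ^ i)" for i
    using w[of i] L_const[of 0] by (cases "i = 1") auto
  have Lf: "L (f n) = L1 * (\<Sum>i<n. a i * (of_real \<rho> * w) ^ i)" for n
  proof -
    have "L (f n) = (\<Sum>i<n. (a i * of_real \<rho> ^ i) * (if i = 1 then 0 else L1 * w ^ i))"
      unfolding f_def using mono by (subst L_sum) (auto simp only: hardy_inf1_cmult L_cmult Lmono finite_lessThan)
    also have "\<dots> = L1 * (\<Sum>i<n. a i * (of_real \<rho> * w) ^ i)"
      unfolding sum_distrib_left by (rule sum.cong) (auto simp: a1 power_mult_distrib)
    finally show ?thesis .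
  qed
  \<comment> \<open>The point (1 + \<rho>)/2 lies strictly between \<rho> and 1; convergence there
    gives absolute convergence at \<rho>.\<close>
  have "summable (\<lambda>n. norm (a n * of_real \<rho> ^ n))"
  proof (rule powser_insidea)
    show "summable (\<lambda>n. a n * of_real ((1 + \<rho>) / 2) ^ n)"
      using ser[of "of_real ((1 + \<rho>) / 2)"] \<rho> unfolding norm_of_real by (auto simp: sums_iff)
    show "norm (complex_of_real \<rho>) < norm (complex_of_real ((1 + \<rho>) / 2))"
      using \<rho> unfolding norm_of_real by simp
  qed
  then have summ: "summable (\<lambda>n. norm (a n) * \<rho> ^ n)" using \<rho> by (simp add: norm_mult norm_power)
  define e where "e n = (\<Sum>i. norm (a i) * \<rho> ^ i) - (\<Sum>i<n. norm (a i) * \<rho> ^ i)" for n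
  have e0: "e \<longlonglongrightarrow> 0"
    unfolding e_def using tendsto_diff[OF tendsto_const[of "\<Sum>i. norm (a i) * \<rho> ^ i"] summable_LIMSEQ[OF summ]] by simp
  have lim1: "(\<lambda>n. L (f n)) \<longlonglongrightarrow> L (\<lambda>z. k (of_real \<rho> * z))"
  proof (rule L_uniform_limit[OF _ _ _ e0])
    show "f n \<in> hardy_inf1" for n unfolding f_def by (intro hardy_inf1_sum hardy_inf1_cmult mono) auto
    show "(\<lambda>z. k (of_real \<rho> * z)) \<in> hardy_inf1" by (rule dilate_hardy_inf1[OF k \<rho>])
    fix n and z :: complex assume z: "z \<in> unit_disc"
    have lt: "norm (of_real \<rho> * z) < 1" "norm (of_real \<rho> * z) \<le> \<rho>"
      using z \<rho> mult_left_le[of "norm z" \<rho>] by (auto simp: norm_mult)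
    have le: "norm (a i * (of_real \<rho> * z) ^ i) \<le> norm (a i) * \<rho> ^ i" for i
      unfolding norm_mult[of "a i"] norm_power using lt by (intro mult_left_mono power_mono) auto
    have "k (of_real \<rho> * z) - f n z = (\<Sum>i. a (i + n) * (of_real \<rho> * z) ^ (i + n))"
      using ser[OF lt(1)] suminf_minus_initial_segment[of "\<lambda>i. a i * (of_real \<rho> * z) ^ i" n]
      by (simp add: f_eq sums_iff)
    also have "norm \<dots> \<le> (\<Sum>i. norm (a (i + n)) * \<rho> ^ (i + n))"
    proof (rule norm_suminf_le)
      show "summable (\<lambda>i. norm (a (i + n)) * \<rho> ^ (i + n))" using summ by (rule summable_ignore_initial_segment)
    qed (rule le)
    also have "\<dots> = e n" unfolding e_def by (rule suminf_minus_initial_segment[OF summ])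
    finally show "norm (k (of_real \<rho> * z) - f n z) \<le> e n" .
  qed
  have "norm (of_real \<rho> * w) < 1"
    using w1 \<rho> mult_left_le[of "norm w" \<rho>] by (auto simp: norm_mult)
  then have lim2: "(\<lambda>n. L (f n)) \<longlonglongrightarrow> L1 * k (of_real \<rho> * w)"
    unfolding Lf using ser[unfolded sums_def] by (intro tendsto_mult tendsto_const) auto
  show ?thesis by (rule LIMSEQ_unique[OF lim1 lim2])
qed

text \<open>Monomials are bounded by 1 on the disc, so the powers of \<open>w\<close> stay bounded.
  The shift by 2 keeps the exponent away from 1.\<close>

lemma norm_w_le_1:
  assumes w: "\<And>n. n \<noteq> 1 \<Longrightarrow> L (\<lambda>z. z ^ n) = L1 * w ^ n"
  shows "norm w \<le> 1"
proof (rule ccontr)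
  assume "\<not> norm w \<le> 1"
  then obtain n where n: "K / norm L1 < norm w ^ n" using real_arch_pow[of "norm w"] by auto
  have le: "norm w ^ n \<le> norm w ^ (n + 2)" using \<open>\<not> norm w \<le> 1\<close> by (intro power_increasing) auto
  have "norm (L (\<lambda>z. z ^ (n + 2))) \<le> K * 1"
    by (rule L_bound[OF monomial_hardy_inf1]) (auto simp: norm_power power_le_one simp del: power_Suc)
  moreover have "L (\<lambda>z. z ^ (n + 2)) = L1 * w ^ (n + 2)" by (rule w) simp
  ultimately have "norm L1 * norm w ^ (n + 2) \<le> K" by (simp only: norm_mult norm_power mult_1_right)
  then have "norm w ^ (n + 2) \<le> K / norm L1" using L1_nonzero by (simp add: field_simps)
  then show False using n le by linarith
qed

text \<open>A boundary point is impossible: the bounded function \<open>exp (\<i> Ln (1 - (z/w)\<^sup>2))\<close> oscillates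
  along the radius towards \<open>w\<close>.\<close>

lemma norm_w_less_1:
  assumes w: "\<And>n. n \<noteq> 1 \<Longrightarrow> L (\<lambda>z. z ^ n) = L1 * w ^ n"
    and dil: "\<And>k e. k \<in> hardy_inf1 \<Longrightarrow> 0 < e \<Longrightarrow>
      \<exists>\<rho>0<1. \<forall>\<rho>. \<rho>0 < \<rho> \<longrightarrow> 0 \<le> \<rho> \<longrightarrow> \<rho> < 1 \<longrightarrow> norm (L k - L (\<lambda>z. k (of_real \<rho> * z))) < e"
  shows "norm w < 1"
proof (rule ccontr)
  assume "\<not> norm w < 1"
  then have w1: "norm w = 1" using norm_w_le_1[OF w] by simp
  then have wnz: "w \<noteq> 0" by auto
  \<comment> \<open>The square makes \<open>k\<close> even, so its derivative at 0 vanishes. Its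
    modulus depends only on the imaginary part of the logarithm, which is bounded.\<close>
  define k where "k z = exp (\<i> * Ln (1 - (z / w)\<^sup>2))" for z
  have np: "1 - (z / w)\<^sup>2 \<notin> \<real>\<^sub>\<le>\<^sub>0" if "z \<in> unit_disc" for z
  proof -
    have "norm ((z / w)\<^sup>2) < 1" using that w1 by (simp add: norm_power norm_divide power_less_one_iff)
    then have "0 < Re (1 - (z / w)\<^sup>2)" using complex_Re_le_cmod[of "(z / w)\<^sup>2"] by simp
    then show ?thesis by (auto simp: complex_nonpos_Reals_iff)
  qed
  have hol: "k holomorphic_on unit_disc"
    unfolding k_def by (intro holomorphic_intros) (use np wnz in auto)
  have kmem: "k \<in> hardy_inf1"
  proof (rule hardy_inf1I[OF hol])
    fix z :: complex assume "z \<in> unit_disc"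
    then have "1 - (z / w)\<^sup>2 \<noteq> 0" using np by force
    then show "norm (k z) \<le> exp pi"
      using mpi_less_Im_Ln[of "1 - (z / w)\<^sup>2"] by (simp add: k_def)
  next
    have "(k has_field_derivative 0) (at 0)"
      unfolding k_def using wnz by (auto intro!: derivative_eq_intros)
    then show "deriv k 0 = 0" by (rule DERIV_imp_deriv)
  qed
  \<comment> \<open>The tolerance is half the distance between \<open>L1\<close> and
    \<open>- L1\<close>, the two values that will alternate below.\<close>
  obtain \<rho>0 where \<rho>0: "\<rho>0 < 1" "\<And>\<rho>. \<rho>0 < \<rho> \<Longrightarrow> 0 \<le> \<rho> \<Longrightarrow> \<rho> < 1 \<Longrightarrow> norm (L k - L (\<lambda>z. k (of_real \<rho> * z))) < norm L1"
    using dil[OF kmem, of "norm L1"] L1_nonzero by auto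
  \<comment> \<open>Solves 1 - \<rho>^2 = exp(-n \<pi>), so that the logarithm at \<rho> w equals -n
    \<pi> and \<open>k\<close> takes the values 1 and -1 alternately.\<close>
  define \<rho> where "\<rho> n = sqrt (1 - exp (- (real n * pi)))" for n
  have \<rho>: "0 \<le> \<rho> n" "\<rho> n < 1" for n by (auto simp: \<rho>_def)
  have k\<rho>: "k (of_real (\<rho> n) * w) = (- 1) ^ n" for n
  proof -
    have "(\<rho> n)\<^sup>2 = 1 - exp (- (real n * pi))" by (simp add: \<rho>_def)
    then have "1 - (of_real (\<rho> n) * w / w)\<^sup>2 = complex_of_real (exp (- (real n * pi)))"
      using wnz by (simp flip: of_real_power)
    then have "k (of_real (\<rho> n) * w) = exp (\<i> * of_real (- (real n * pi)))"
      unfolding k_def by (simp only: Ln_of_real[OF exp_gt_zero] ln_exp)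
    also have "\<dots> = cis (- (real n * pi))" by (simp add: cis_conv_exp)
    also have "\<dots> = (- 1) ^ n"
      by (simp add: complex_eq_iff cos_npi sin_npi)
    finally show ?thesis .
  qed
  have "(\<lambda>n. \<rho> n) \<longlonglongrightarrow> 1"
    unfolding \<rho>_def by real_asymp
  then have "eventually (\<lambda>n. \<rho>0 < \<rho> n) sequentially" using \<rho>0(1) by (rule order_tendstoD(1))
  then obtain N where N: "\<And>n. n \<ge> N \<Longrightarrow> \<rho>0 < \<rho> n" by (auto simp: eventually_sequentially)
  have est: "norm (L k - L1 * (- 1) ^ n) < norm L1" if "n \<ge> N" for n
    using \<rho>0(2)[OF N[OF that] \<rho>] L_dilate[OF w norm_w_le_1[OF w] hol hardy_inf1_deriv[OF kmem] \<rho>, of n]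
    by (simp add: k\<rho>)
  have "norm (L k - L1) < norm L1" "norm (L k + L1) < norm L1"
    using est[of "2 * N"] est[of "2 * N + 1"] by auto
  moreover have "2 * norm L1 = norm ((L k + L1) - (L k - L1))"
    by (simp add: norm_mult flip: mult_2)
  moreover have "\<dots> \<le> norm (L k + L1) + norm (L k - L1)" by (rule norm_triangle_ineq4)
  ultimately show False by linarith
qed

end

section \<open>Transfer to the multiplier algebra and evaluation at \<open>w\<close>\<close>

theorem theorem4p1:
  fixes p :: real and \<alpha> \<beta> :: complex
    and \<Lambda> :: "(complex \<Rightarrow> complex) \<Rightarrow> complex"
  assumes "1 \<le> p"
    and "(norm \<alpha>)\<^sup>2 + (norm \<beta>)\<^sup>2 = 1"
    and "\<alpha> \<noteq> 0"
    and "linear_functional_on (hardy_ab p \<alpha> \<beta>) \<Lambda>"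
    and "hardy_continuous_on p (hardy_ab p \<alpha> \<beta>) \<Lambda>"
    and "\<And>f. cyclic p \<alpha> \<beta> f \<Longrightarrow> \<Lambda> f \<noteq> 0"
  shows "\<exists>c w. c \<noteq> 0 \<and> w \<in> unit_disc \<and> (\<forall>f\<in>hardy_ab p \<alpha> \<beta>. \<Lambda> f = c * f w)"
proof -
  note p = \<open>1 \<le> p\<close> and a = \<open>\<alpha> \<noteq> 0\<close> and nz = assms(6)
  have p0: "0 < p" using p by simp
  let ?X = "hardy_ab p \<alpha> \<beta>"
  note iff = hardy_ab_iff[OF p0 a]
  have add: "\<Lambda> (\<lambda>z. f z + g z) = \<Lambda> f + \<Lambda> g" if "f \<in> ?X" "g \<in> ?X" for f g
    using assms(4) that by (simp add: linear_functional_on_def)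
  have scale: "\<Lambda> (\<lambda>z. c * f z) = c * \<Lambda> f" if "f \<in> ?X" for f c
    using assms(4) that by (simp add: linear_functional_on_def)
  have Xscale: "(\<lambda>z. c * f z) \<in> ?X" if "f \<in> ?X" for c f
    using that hardy_cmult[OF _ p0, of f c] unfolding iff
    by (auto simp: deriv_cmult holomorphic_on_imp_differentiable_at[OF hardy_holomorphic open_ball])
  have Xzero: "(\<lambda>z. 0) \<in> ?X" unfolding iff using hardy_const[of 0] by simp
  have "?X \<subseteq> hardy p" by (auto simp: iff)
  then obtain K where K: "K > 0" "\<And>f. f \<in> ?X \<Longrightarrow> norm (\<Lambda> f) \<le> K * hardy_norm p f"
    using linear_functional_bound[OF p0 _ Xzero Xscale assms(4,5)] by blast
  define \<gamma> where "\<gamma> = \<beta> / \<alpha>"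
  define E where "E z = exp (\<gamma> * z)" for z
  define B where "B = exp (norm \<gamma>)"
  have holE: "E holomorphic_on unit_disc" unfolding E_def by (intro holomorphic_intros)
  have \<gamma>z: "norm (\<gamma> * z) \<le> norm \<gamma>" if "z \<in> unit_disc" for z
    using that mult_left_le[of "norm z" "norm \<gamma>"] by (simp add: norm_mult)
  have E_upper: "norm (E z) \<le> B" if "z \<in> unit_disc" for z
    unfolding E_def B_def using order_trans[OF norm_exp] \<gamma>z[OF that] by (metis exp_le_cancel_iff)
  have dE: "deriv E 0 = \<gamma>"
    unfolding E_def by (rule DERIV_imp_deriv) (auto intro!: derivative_eq_intros)
  have eqE: "\<alpha> * deriv E 0 = \<beta> * E 0" unfolding dE using a by (simp add: E_def \<gamma>_def)
  have memE: "(\<lambda>z. E z * h z) \<in> ?X" if "h \<in> hardy p" "deriv h 0 = 0" for h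
    by (rule hardy_ab_mult[OF p0 a holE E_upper eqE that])
  have memE1: "(\<lambda>z. E z * h z) \<in> ?X" if "h \<in> hardy_inf1" for h
    using that by (intro memE hardy_inf1_hardy hardy_inf1_deriv p0)
  define L where "L h = \<Lambda> (\<lambda>z. E z * h z)" for h
  interpret zero_free_functional_inf1 L "K * B"
  proof
    show "L (\<lambda>z. f z + g z) = L f + L g" if "f \<in> hardy_inf1" "g \<in> hardy_inf1" for f g
      using add[OF memE1 memE1, OF that] by (simp add: L_def distrib_left)
    show "L (\<lambda>z. c * f z) = c * L f" if "f \<in> hardy_inf1" for f c
      using scale[OF memE1, OF that, of c] by (simp add: L_def mult.left_commute)
    show "0 < K * B" using K by (simp add: B_def)
    show "norm (L f) \<le> K * B * C" if f: "f \<in> hardy_inf1" "\<And>z. z \<in> unit_disc \<Longrightarrow> norm (f z) \<le> C" for f C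
    proof -
      have "0 \<le> C" using order_trans[OF norm_ge_zero f(2)[of 0]] by simp
      then have "hardy_norm p (\<lambda>z. E z * f z) \<le> B * C"
        using hardy_inf1_holomorphic[OF f(1)] holE p0 E_upper f(2)
        by (intro hardy_norm_le_bound) (auto simp: B_def norm_mult intro!: holomorphic_intros mult_mono)
      then have "K * hardy_norm p (\<lambda>z. E z * f z) \<le> K * (B * C)" using K by simp
      then show ?thesis using K(2)[OF memE1[OF f(1)]] by (simp add: L_def mult.assoc)
    qed
    show "L (\<lambda>z. exp (f z)) \<noteq> 0" if f: "f \<in> hardy_inf1" for f
      unfolding L_def
    proof (rule nz)
      obtain C where C: "\<And>z. z \<in> unit_disc \<Longrightarrow> norm (f z) \<le> C" using hardy_inf1_bound[OF f] by blast
      have eq: "E z * exp (f z) = exp (\<gamma> * z + f z)" for z by (simp add: E_def exp_add)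
      have le: "norm (\<gamma> * z + f z) \<le> norm \<gamma> + C" if "z \<in> unit_disc" for z
        using \<gamma>z[OF that] C[OF that] by (rule norm_triangle_mono)
      show "cyclic p \<alpha> \<beta> (\<lambda>z. E z * exp (f z))"
      proof (rule cyclicI[OF p a])
        show "(\<lambda>z. E z * exp (f z)) holomorphic_on unit_disc"
          by (intro holomorphic_intros holE hardy_inf1_holomorphic f)
        show "norm (E z * exp (f z)) \<le> exp (norm \<gamma> + C)" if "z \<in> unit_disc" for z
          unfolding eq using order_trans[OF norm_exp] le[OF that] by (metis exp_le_cancel_iff)
        show "exp (- (norm \<gamma> + C)) \<le> norm (E z * exp (f z))" if "z \<in> unit_disc" for z
          unfolding eq norm_exp_eq_Re using le[OF that] abs_Re_le_cmod[of "\<gamma> * z + f z"] by simp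
        show "\<alpha> * deriv (\<lambda>z. E z * exp (f z)) 0 = \<beta> * (E 0 * exp (f 0))"
          using memE1[OF exp_hardy_inf1[OF f]] by (simp add: iff)
      qed simp
    qed
  qed
  \<comment> \<open>Stated for all of H^p because it serves twice: for bounded \<open>k\<close> to
    place \<open>w\<close> inside the disc, and for unbounded \<open>k\<close> to reach every
    element of the space.\<close>
  have dil: "\<exists>\<rho>0<1. \<forall>\<rho>. \<rho>0 < \<rho> \<longrightarrow> 0 \<le> \<rho> \<longrightarrow> \<rho> < 1 \<longrightarrow> norm (L k - L (\<lambda>z. k (of_real \<rho> * z))) < e"
    if k: "k \<in> hardy p" "deriv k 0 = 0" and e: "0 < e" for k e
  proof -
    obtain \<rho>0 where \<rho>0: "\<rho>0 < 1" "\<And>\<rho>. \<rho>0 < \<rho> \<Longrightarrow> \<rho> < 1 \<Longrightarrow>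
        hardy_norm p (\<lambda>z. E z * k z - E z * k (of_real \<rho> * z)) < e / K"
      using dilation_approx[OF k(1) p _ holE E_upper, of "e / K"] e K by auto
    have "norm (L k - L (\<lambda>z. k (of_real \<rho> * z))) < e" if \<rho>: "\<rho>0 < \<rho>" "0 \<le> \<rho>" "\<rho> < 1" for \<rho>
    proof -
      have m: "(\<lambda>z. E z * k z) \<in> ?X" "(\<lambda>z. E z * k (of_real \<rho> * z)) \<in> ?X"
        using memE[OF k] memE1[OF dilate_hardy_inf1[OF hardy_holomorphic[OF k(1)] k(2) \<rho>(2,3)]] by auto
      \<comment> \<open>A dilation fixes 0, so the difference has the value
        \<open>E 0 * k 0 - E 0 * k 0\<close> there.\<close>
      have d: "(\<lambda>z. E z * k z - E z * k (of_real \<rho> * z)) \<in> hardy p" "\<alpha> * deriv (\<lambda>z. E z * k z - E z * k (of_real \<rho> * z)) 0 = \<beta> * (E 0 * k 0 - E 0 * k 0)"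
      proof -
        show "(\<lambda>z. E z * k z - E z * k (of_real \<rho> * z)) \<in> hardy p" using m by (intro hardy_diff p0) (auto simp: iff)
        have "deriv (\<lambda>z. E z * k z - E z * k (of_real \<rho> * z)) 0 = deriv (\<lambda>z. E z * k z) 0 - deriv (\<lambda>z. E z * k (of_real \<rho> * z)) 0"
          using m unfolding iff by (intro deriv_diff holomorphic_on_imp_differentiable_at[of _ unit_disc] hardy_holomorphic[of _ p]) auto
        then show "\<alpha> * deriv (\<lambda>z. E z * k z - E z * k (of_real \<rho> * z)) 0 = \<beta> * (E 0 * k 0 - E 0 * k 0)"
          using m unfolding iff by (simp add: right_diff_distrib)
      qed
      have "\<Lambda> (\<lambda>z. E z * k z - E z * k (of_real \<rho> * z)) = L k - L (\<lambda>z. k (of_real \<rho> * z))"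
        using add[OF m(1) Xscale[OF m(2), of "-1"]] scale[OF m(2), of "-1"] by (simp add: L_def)
      then have "norm (L k - L (\<lambda>z. k (of_real \<rho> * z))) \<le> K * hardy_norm p (\<lambda>z. E z * k z - E z * k (of_real \<rho> * z))"
        using K(2)[of "\<lambda>z. E z * k z - E z * k (of_real \<rho> * z)"] d by (simp add: iff)
      also have "\<dots> < e" using \<rho>0(2)[OF \<rho>(1,3)] K(1) by (simp add: field_simps)
      finally show ?thesis .
    qed
    then show ?thesis using \<rho>0(1) by blast
  qed
  obtain w where w: "\<And>n. n \<noteq> 1 \<Longrightarrow> L (\<lambda>z. z ^ n) = L1 * w ^ n" using L_monomial by blast
  have w1: "norm w < 1"
    by (rule norm_w_less_1[OF w]) (use dil hardy_inf1_hardy[OF _ p0] hardy_inf1_deriv in blast)+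
  have "\<Lambda> f = L1 * exp (- \<gamma> * w) * f w" if f: "f \<in> ?X" for f
  proof -
    \<comment> \<open>Division by \<open>E\<close> undoes the twist: the relation satisfied by
      \<open>f\<close> becomes k'(0) = 0.\<close>
    define k where "k z = f z * exp (- \<gamma> * z)" for z
    have fk: "f z = E z * k z" for z by (simp add: k_def E_def exp_minus)
    have f': "f \<in> hardy p" "\<alpha> * deriv f 0 = \<beta> * f 0" using f by (auto simp: iff)
    have hole: "(\<lambda>z. exp (- \<gamma> * z)) holomorphic_on unit_disc" by (intro holomorphic_intros)
    have k: "k \<in> hardy p" unfolding k_def
    proof (rule hardy_mult_bounded[OF f'(1) hole _ p0])
      show "norm (exp (- \<gamma> * z)) \<le> B" if "z \<in> unit_disc" for z
        using order_trans[OF norm_exp[of "- \<gamma> * z"], of B] \<gamma>z[OF that] by (simp add: B_def)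
    qed
    have "deriv (\<lambda>z. exp (- \<gamma> * z)) 0 = - \<gamma>"
      by (rule DERIV_imp_deriv) (auto intro!: derivative_eq_intros)
    then have "deriv k 0 = deriv f 0 - \<gamma> * f 0"
      unfolding k_def using holomorphic_deriv_mult_at_0[OF hardy_holomorphic[OF f'(1)] hole] by simp
    then have dk: "deriv k 0 = 0" using f'(2) a by (simp add: \<gamma>_def field_simps)
    have Lk: "L k = \<Lambda> f" using fk by (simp add: L_def fun_eq_iff flip: fk)
    have hk: "k holomorphic_on unit_disc" using k by (rule hardy_holomorphic)
    have "isCont k w" using hk w1 by (intro continuous_on_interior[OF holomorphic_on_imp_continuous_on]) auto
    \<comment> \<open>As \<open>k\<close> may be unbounded, the formula for \<open>L\<close> is
      available on its dilations only. Their values have two limits as \<rho> tends to 1: one by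
      continuity of \<open>k\<close> at the interior point \<open>w\<close>, the other by
      \<open>dil\<close>.\<close>
    have "((\<lambda>\<rho>. L1 * k (of_real \<rho> * w)) \<longlongrightarrow> L1 * k w) (at_left 1)"
    proof (intro tendsto_mult tendsto_const isCont_tendsto_compose[OF \<open>isCont k w\<close>])
      have "((\<lambda>\<rho>. complex_of_real \<rho> * w) \<longlongrightarrow> of_real 1 * w) (at_left 1)" by (intro tendsto_intros)
      then show "((\<lambda>\<rho>. complex_of_real \<rho> * w) \<longlongrightarrow> w) (at_left 1)" by simp
    qed
    moreover have "((\<lambda>\<rho>. L1 * k (of_real \<rho> * w)) \<longlongrightarrow> L k) (at_left 1)"
    proof (rule tendstoI)
      fix e :: real assume "0 < e"
      from dil[OF k dk this] obtain \<rho>0 where \<rho>0: "\<rho>0 < 1"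
        "\<And>\<rho>. \<rho>0 < \<rho> \<Longrightarrow> 0 \<le> \<rho> \<Longrightarrow> \<rho> < 1 \<Longrightarrow> norm (L k - L (\<lambda>z. k (of_real \<rho> * z))) < e" by blast
      have "eventually (\<lambda>\<rho>. \<rho> \<in> {max 0 \<rho>0<..<1}) (at_left 1)"
        \<comment> \<open>The threshold may be negative, whereas dilations are taken with \<rho>
          \<ge> 0.\<close>
        using \<rho>0(1) by (intro eventually_at_leftI[of "max 0 \<rho>0"]) auto
      then show "eventually (\<lambda>\<rho>. dist (L1 * k (of_real \<rho> * w)) (L k) < e) (at_left 1)"
      proof eventually_elim
        case (elim \<rho>)
        then have "L (\<lambda>z. k (of_real \<rho> * z)) = L1 * k (of_real \<rho> * w)"
          using w1 by (intro L_dilate[OF w _ hk dk]) auto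
        then show ?case using \<rho>0(2)[of \<rho>] elim by (simp add: dist_norm norm_minus_commute)
      qed
    qed
    ultimately have "L1 * k w = L k" by (rule tendsto_unique[OF trivial_limit_at_left_real])
    then show ?thesis by (simp add: Lk k_def mult_ac)
  qed
  then show ?thesis using w1 L1_nonzero
    by (intro exI[of _ "L1 * exp (- \<gamma> * w)"] exI[of _ w]) auto
qed

end
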